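(* Let $n$ be a non-negative integer, and let $a,b$ be complex numbers such that $(a)_n\neq 0$ and $a-b$ is not zero or a negative integer. Then $$ {}_2F_1\!\left(\left.{a+n,\;b \atop a-b}\right| -1\right)= P(n)\,\frac{\Gamma(a-b)\,\Gamma(\frac{a+1}{2})}{\Gamma(a)\,\Gamma(\frac{a+1}{2}-b)}+Q(n)\,\frac{\Gamma(a-b)\,\Gamma(\frac{a}{2})}{\Gamma(a)\,\Gamma(\frac{a}{2}-b)}, $$ where $$ P(n)=\frac12\;{}_3F_2\!\left({-\frac n2,\,-\frac{n+1}{2},\,b\atop -n,\;\frac a2}\right),\qquad Q(n)=\frac12\;{}_3F_2\!\left({-\frac{n-1}{2},\,-\frac n2,\,b\atop -n,\;\frac{a+1}{2}}\right), $$ the hypergeometric sums being interpreted as terminating sums, that is, $$ P(n)=\frac12\sum_{k=0}^{\lceil n/2\rceil}\frac{(-\frac n2)_k\,(-\frac{n+1}{2})_k\,(b)_k}{(-n)_k\,(\frac a2)_k\,k!},\qquad Q(n)=\frac12\sum_{k=0}^{\lfloor n/2\rfloor}\frac{(-\frac{n-1}{2})_k\,(-\frac{n}{2})_k\,(b)_k}{(-n)_k\,(\frac{a+1}{2})_k\,k!}. $$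
   Context: Notation: $(x)_k=x(x+1)\cdots(x+k-1)$ for $k\ge 0$, with $(x)_0=1$. ${}_2F_1\!\left(\left.{A,B\atop C}\right|z\right)$, for $C\notin\{0,-1,-2,\dots\}$, denotes the analytic continuation to $\mathbb{C}\setminus[1,\infty)$ of the hypergeometric series $\sum_{k\ge0}\frac{(A)_k(B)_k}{(C)_k\,k!}z^k$. ${}_3F_2\!\left({A,B,C\atop E,F}\right)$ denotes the hypergeometric series at argument $1$, $\sum_{k}\frac{(A)_k(B)_k(C)_k}{(E)_k(F)_k\,k!}$; here it is understood as the finite sums written in the claim. The Gamma quotients are understood by continuity in $a$: $\Gamma(\frac{a+1}{2})/\Gamma(a)=2^{1-a}\sqrt\pi/\Gamma(\frac a2)$ and $\Gamma(\frac a2)/\Gamma(a)=2^{1-a}\sqrt\pi/\Gamma(\frac{a+1}{2})$, which are entire functions of $a$; $1/\Gamma$ is taken to be $0$ at the poles of $\Gamma$. *)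

theory Defs
  imports "HOL-Complex_Analysis.Complex_Analysis"
begin

definition slit_plane :: "complex set" where
  "slit_plane = - (complex_of_real ` {1..})"

text \<open>
  For \<open>C\<close> not a non-positive integer, the function chosen below exists; by the identity
  theorem its values on \<open>slit_plane\<close> (which is connected) are uniquely determined.
  Its values on the cut \<open>[1, \<infinity>)\<close> are unspecified.
\<close>

definition hyp2F1 :: "complex \<Rightarrow> complex \<Rightarrow> complex \<Rightarrow> complex \<Rightarrow> complex" where
  "hyp2F1 A B C = (SOME F. F holomorphic_on slit_plane \<and>
     (\<forall>z\<in>ball 0 1.
        (\<lambda>k. pochhammer A k * pochhammer B k / (pochhammer C k * fact k) * z ^ k) sums F z))"

text \<open>
  The continuous extensions to all complex \<open>a\<close> of the quotients
  \<open>Gamma ((a + 1) / 2) / Gamma a\<close> and \<open>Gamma (a / 2) / Gamma a\<close>, obtained from the Legendre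
  duplication formula. They are entire in \<open>a\<close>; the lemmas ending in \<open>_eq\<close> show that they agree with
  the plain quotients away from the poles.
\<close>

definition Gamma_quot_odd :: "complex \<Rightarrow> complex" where
  "Gamma_quot_odd a = 2 powr (1 - a) * of_real (sqrt pi) * rGamma (a / 2)"

definition Gamma_quot_even :: "complex \<Rightarrow> complex" where
  "Gamma_quot_even a = 2 powr (1 - a) * of_real (sqrt pi) * rGamma ((a + 1) / 2)"

lemma Gamma_halves_product:
  fixes a :: complex
  assumes "a \<notin> \<int>\<^sub>\<le>\<^sub>0"
  shows "a / 2 \<notin> \<int>\<^sub>\<le>\<^sub>0" and "(a + 1) / 2 \<notin> \<int>\<^sub>\<le>\<^sub>0"
    and "Gamma (a / 2) * Gamma ((a + 1) / 2) = 2 powr (1 - a) * of_real (sqrt pi) * Gamma a"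
proof -
  show 1: "a / 2 \<notin> \<int>\<^sub>\<le>\<^sub>0"
  proof
    assume "a / 2 \<in> \<int>\<^sub>\<le>\<^sub>0"
    then obtain m where "a / 2 = - of_nat m" by (elim nonpos_Ints_cases')
    hence "a = - of_nat (2 * m)" by (simp add: field_simps)
    with assms show False by (metis minus_of_nat_in_nonpos_Ints)
  qed
  show 2: "(a + 1) / 2 \<notin> \<int>\<^sub>\<le>\<^sub>0"
  proof
    assume "(a + 1) / 2 \<in> \<int>\<^sub>\<le>\<^sub>0"
    then obtain m where "(a + 1) / 2 = - of_nat m" by (elim nonpos_Ints_cases')
    hence "a + 1 = - (2 * of_nat m)" by (simp add: field_simps)
    hence "a = - (2 * of_nat m) - 1" by (metis add_diff_cancel_right')
    hence "a = - of_nat (2 * m + 1)" by simp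
    with assms show False by (metis minus_of_nat_in_nonpos_Ints)
  qed
  have "Ln (2::complex) = of_real (ln 2)"
    using Ln_of_real[of 2] by simp
  thus "Gamma (a / 2) * Gamma ((a + 1) / 2) = 2 powr (1 - a) * of_real (sqrt pi) * Gamma a"
    using Gamma_legendre_duplication[of "a / 2"] 1 2
    by (simp add: powr_def add_divide_distrib)
qed

lemma Gamma_quot_odd_eq:
  assumes "a \<notin> \<int>\<^sub>\<le>\<^sub>0"
  shows "Gamma_quot_odd a = Gamma ((a + 1) / 2) / Gamma a"
  using Gamma_halves_product[OF assms] assms
  by (simp add: Gamma_quot_odd_def rGamma_inverse_Gamma Gamma_eq_zero_iff field_simps)

lemma Gamma_quot_even_eq:
  assumes "a \<notin> \<int>\<^sub>\<le>\<^sub>0"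
  shows "Gamma_quot_even a = Gamma (a / 2) / Gamma a"
  using Gamma_halves_product[OF assms] assms
  by (simp add: Gamma_quot_even_def rGamma_inverse_Gamma Gamma_eq_zero_iff field_simps)

definition P_coeff :: "complex \<Rightarrow> complex \<Rightarrow> nat \<Rightarrow> complex" where
  "P_coeff a b n = 1 / 2 * (\<Sum>k = 0..nat \<lceil>real n / 2\<rceil>.
     pochhammer (- (of_nat n / 2)) k * pochhammer (- ((of_nat n + 1) / 2)) k * pochhammer b k /
     (pochhammer (- of_nat n) k * pochhammer (a / 2) k * fact k))"

definition Q_coeff :: "complex \<Rightarrow> complex \<Rightarrow> nat \<Rightarrow> complex" where
  "Q_coeff a b n = 1 / 2 * (\<Sum>k = 0..nat \<lfloor>real n / 2\<rfloor>.
     pochhammer (- ((of_nat n - 1) / 2)) k * pochhammer (- (of_nat n / 2)) k * pochhammer b k /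
     (pochhammer (- of_nat n) k * pochhammer ((a + 1) / 2) k * fact k))"

end

theory Submission
  imports Defs
begin

text \<open>
  Pfaff's transformation turns the value at -1 into \<open>2 powr (- b)\<close> times the absolutely convergent
  series \<open>H n\<close> with parameters \<open>- b - n, b; a - b\<close> at \<open>1/2\<close>. A contiguous relation gives
  \<open>2 (a + n) H (n + 1) = (2 a + 3 n) H n - (n + b) H (n - 1)\<close>, and \<open>P\<close> and \<open>Q\<close> satisfy the same
  recurrence, with \<open>P = 1\<close>, \<open>Q = 0\<close> at \<open>n = -1\<close>. The initial values at \<open>n = -1\<close> and \<open>n = 0\<close> come from
  Bailey's evaluation of the series with parameters \<open>1 - b, b; C\<close> at \<open>1/2\<close>, which follows from its
  first-order recurrence \<open>C \<rightarrow> C + 2\<close> and the limit \<open>C \<rightarrow> \<infinity>\<close>.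
  The continuation to the slit plane, and Pfaff's transformation for it, are obtained from the
  hypergeometric differential equation, written with the Euler operator \<open>z d/dz\<close>.
\<close>

section \<open>The hypergeometric differential equation\<close>

text \<open>The point -1 lies on the circle of convergence, where the series itself can diverge, and
  \<open>hyp2F1\<close> is a \<open>SOME\<close>; a continuation has to be constructed before
  anything can be said about its value. The substitution y = z / (z - 1) moves -1 to the interior
  point 1/2. Since C - A = (a - b) - (a + n) = - b - n, raising n by one changes a single numerator
  parameter, which is why a three-term relation in that parameter suffices. Stepping back to n = -1
  lands on the parameters 1 - b, b, and n = 0 is a combination of Bailey's values at the
  denominators a - b and a - b + 1: these two values are the source of the two Gamma products in the
  claim. The recurrence is solved for its top term by dividing by factors a + j of (a)_n, all
  nonzero. Bailey's formula supplies 1 / Gamma (a / 2) and 1 / Gamma ((a + 1) / 2) directly, so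
  poles of Gamma at a call for no limit argument.\<close>

definition hyp_coeff :: "complex \<Rightarrow> complex \<Rightarrow> complex \<Rightarrow> nat \<Rightarrow> complex" where
  "hyp_coeff A B C k = pochhammer A k * pochhammer B k / (pochhammer C k * fact k)"

text \<open>A relation rather than an operator, so that closed forms T for \<theta> f can be
  supplied by hand, \<theta> being the Euler operator. \<theta> multiplies the k-th Taylor
  coefficient by k and only picks up a factor under a substitution, which keeps coefficient
  comparisons and changes of variable short.\<close>

definition euler_deriv_on :: "(complex \<Rightarrow> complex) \<Rightarrow> (complex \<Rightarrow> complex) \<Rightarrow> complex set \<Rightarrow> bool" where
  "euler_deriv_on f T S \<longleftrightarrow> (\<forall>z\<in>S. \<exists>D. (f has_field_derivative D) (at z) \<and> T z = z * D)"

text \<open>This is \<theta> (\<theta> + C - 1) f = z (\<theta> + A) (\<theta> + B) f multiplied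
  out, with T = \<theta> f and U = \<theta> T.\<close>

definition hyp_solution :: "complex \<Rightarrow> complex \<Rightarrow> complex \<Rightarrow> (complex \<Rightarrow> complex) \<Rightarrow> complex set \<Rightarrow> bool" where
  "hyp_solution A B C f S \<longleftrightarrow> f 0 = 1 \<and> (\<exists>T U. euler_deriv_on f T S \<and> euler_deriv_on T U S \<and>
     (\<forall>z\<in>S. (1 - z) * U z + (C - 1 - (A + B) * z) * T z - A * B * z * f z = 0))"

lemma euler_deriv_on_imp_holomorphic: "euler_deriv_on f T S \<Longrightarrow> f holomorphic_on S"
  unfolding euler_deriv_on_def holomorphic_on_def
  by (meson DERIV_subset field_differentiable_def top_greatest)

lemma euler_deriv_on_eq_deriv: "euler_deriv_on f T S \<Longrightarrow> z \<in> S \<Longrightarrow> T z = z * deriv f z"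
  unfolding euler_deriv_on_def by (metis DERIV_imp_deriv)

lemma euler_deriv_on_mult:
  assumes "euler_deriv_on f T S" "euler_deriv_on g U S"
  shows "euler_deriv_on (\<lambda>z. f z * g z) (\<lambda>z. T z * g z + f z * U z) S"
  unfolding euler_deriv_on_def
proof
  fix z assume "z \<in> S"
  then obtain D E where "(f has_field_derivative D) (at z)" "T z = z * D"
     "(g has_field_derivative E) (at z)" "U z = z * E"
    using assms unfolding euler_deriv_on_def by meson
  thus "\<exists>D. ((\<lambda>z. f z * g z) has_field_derivative D) (at z) \<and> T z * g z + f z * U z = z * D"
    by (intro exI[of _ "D * g z + f z * E"] conjI)
       (auto intro!: derivative_eq_intros simp: algebra_simps)
qed

lemma euler_deriv_on_add:
  assumes "euler_deriv_on f T S" "euler_deriv_on g U S"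
  shows "euler_deriv_on (\<lambda>z. f z + g z) (\<lambda>z. T z + U z) S"
  unfolding euler_deriv_on_def
proof
  fix z assume "z \<in> S"
  then obtain D E where "(f has_field_derivative D) (at z)" "T z = z * D"
     "(g has_field_derivative E) (at z)" "U z = z * E"
    using assms unfolding euler_deriv_on_def by meson
  thus "\<exists>D. ((\<lambda>z. f z + g z) has_field_derivative D) (at z) \<and> T z + U z = z * D"
    by (intro exI[of _ "D + E"] conjI) (auto intro!: derivative_eq_intros simp: algebra_simps)
qed

text \<open>The chain rule, with \<open>\<mu>\<close> in the role of z \<phi>' / \<phi>. The product
  \<open>\<phi> z * \<mu> z\<close> replaces that quotient because \<open>\<phi>\<close> vanishes at
  0 in both applications.\<close>

lemma euler_deriv_on_compose:
  assumes f: "euler_deriv_on f T S'" and \<phi>: "euler_deriv_on \<phi> (\<lambda>z. \<phi> z * \<mu> z) S"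
    and sub: "\<And>z. z \<in> S \<Longrightarrow> \<phi> z \<in> S'"
  shows "euler_deriv_on (\<lambda>z. f (\<phi> z)) (\<lambda>z. \<mu> z * T (\<phi> z)) S"
  unfolding euler_deriv_on_def
proof
  fix z assume z: "z \<in> S"
  obtain D where D: "(f has_field_derivative D) (at (\<phi> z))" "T (\<phi> z) = \<phi> z * D"
    using f sub[OF z] unfolding euler_deriv_on_def by meson
  obtain E where E: "(\<phi> has_field_derivative E) (at z)" "\<phi> z * \<mu> z = z * E"
    using \<phi> z unfolding euler_deriv_on_def by meson
  have "((\<lambda>z. f (\<phi> z)) has_field_derivative D * E) (at z)"
    by (rule DERIV_chain2) (use D E in auto)
  moreover have "\<mu> z * T (\<phi> z) = z * (D * E)"
    using D E by (metis mult.assoc mult.commute)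
  ultimately show "\<exists>D. ((\<lambda>z. f (\<phi> z)) has_field_derivative D) (at z) \<and> \<mu> z * T (\<phi> z) = z * D"
    by blast
qed

lemma hyp_coeff_Suc:
  "of_nat (Suc k) * (C + of_nat k) * hyp_coeff A B C (Suc k) = (A + of_nat k) * (B + of_nat k) * hyp_coeff A B C k"
  if "C \<notin> \<int>\<^sub>\<le>\<^sub>0"
proof -
  have "pochhammer C (Suc k) \<noteq> 0" "C + of_nat k \<noteq> 0" "pochhammer C k \<noteq> 0"
    using that by (auto dest: pochhammer_eq_0_imp_nonpos_Int simp: plus_of_nat_eq_0_imp)
  moreover have "of_nat (Suc k) \<noteq> (0::complex)" by (metis of_nat_neq_0)
  ultimately show ?thesis
    unfolding hyp_coeff_def pochhammer_Suc fact_Suc by (simp add: divide_simps mult_ac del: of_nat_Suc)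
qed

text \<open>Comparing coefficients of z^(k+1) turns the equation into the recursion of
  \<open>hyp_coeff_Suc\<close>, whose leading factor (k + 1) (C + k) never vanishes. Convergence on
  the whole disk is inherited from the holomorphy of \<open>f\<close>.\<close>

lemma hyp_solution_sums:
  assumes sol: "hyp_solution A B C f (ball 0 1)" and C: "C \<notin> \<int>\<^sub>\<le>\<^sub>0" and z: "norm z < 1"
  shows "(\<lambda>k. hyp_coeff A B C k * z ^ k) sums f z"
proof -
  obtain T U where TU: "euler_deriv_on f T (ball 0 1)" "euler_deriv_on T U (ball 0 1)"
    and eq: "\<And>z. z \<in> ball 0 1 \<Longrightarrow> (1 - z) * U z + (C - 1 - (A + B) * z) * T z - A * B * z * f z = 0"
    and f0: "f 0 = 1"
    using sol unfolding hyp_solution_def by metis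
  define F where "F = fps_expansion f 0"
  have holo: "f holomorphic_on ball 0 1" using TU(1) by (rule euler_deriv_on_imp_holomorphic)
  have F: "f has_fps_expansion F"
    unfolding F_def by (rule has_fps_expansion_fps_expansion[of "ball 0 1"]) (use holo in auto)
  have ev: "eventually (\<lambda>z::complex. z \<in> ball 0 1) (nhds 0)"
    by (intro eventually_nhds_in_open) auto
  define F1 where "F1 = fps_X * fps_deriv F"
  define F2 where "F2 = fps_X * fps_deriv F1"
  have T: "T has_fps_expansion F1"
  proof -
    have "(\<lambda>z. z * deriv f z) has_fps_expansion F1"
      unfolding F1_def using F by (intro fps_expansion_intros)
    moreover have "eventually (\<lambda>z. z * deriv f z = T z) (nhds 0)"
      using ev by eventually_elim (metis TU(1) euler_deriv_on_eq_deriv)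
    ultimately show ?thesis by (subst (asm) has_fps_expansion_cong[OF _ refl]) auto
  qed
  have U: "U has_fps_expansion F2"
  proof -
    have "(\<lambda>z. z * deriv T z) has_fps_expansion F2"
      unfolding F2_def using T by (intro fps_expansion_intros)
    moreover have "eventually (\<lambda>z. z * deriv T z = U z) (nhds 0)"
      using ev by eventually_elim (metis TU(2) euler_deriv_on_eq_deriv)
    ultimately show ?thesis by (subst (asm) has_fps_expansion_cong[OF _ refl]) auto
  qed
  have "(\<lambda>z. (1 - z) * U z + (C - 1 - (A + B) * z) * T z - A * B * z * f z) has_fps_expansion
     (1 - fps_X) * F2 + (fps_const C - 1 - fps_const (A + B) * fps_X) * F1
       - fps_const A * fps_const B * fps_X * F"
    by (intro fps_expansion_intros F T U)
  moreover have "(\<lambda>z. (1 - z) * U z + (C - 1 - (A + B) * z) * T z - A * B * z * f z) has_fps_expansion 0"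
    unfolding has_fps_expansion_0_iff using ev by eventually_elim (use eq in auto)
  ultimately have zero: "(1 - fps_X) * F2 + (fps_const C - 1 - fps_const (A + B) * fps_X) * F1
       - fps_const A * fps_const B * fps_X * F = 0"
    by (rule fps_expansion_unique_complex)
  have F1n: "fps_nth F1 k = of_nat k * fps_nth F k" for k
    unfolding F1_def by (cases k) auto
  have F2n: "fps_nth F2 k = of_nat k ^ 2 * fps_nth F k" for k
    unfolding F2_def using F1n by (cases k) (auto simp: power2_eq_square)
  have rec: "of_nat (Suc k) * (C + of_nat k) * fps_nth F (Suc k) = (A + of_nat k) * (B + of_nat k) * fps_nth F k" for k
  proof -
    have "fps_nth ((1 - fps_X) * F2 + (fps_const C - 1 - fps_const (A + B) * fps_X) * F1
       - fps_const A * fps_const B * fps_X * F) (Suc k) = 0"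
      using zero by simp
    hence "fps_nth F2 (Suc k) - fps_nth F2 k + (C - 1) * fps_nth F1 (Suc k) - (A + B) * fps_nth F1 k
        - A * B * fps_nth F k = 0"
      by (simp add: ring_distribs mult.assoc) (simp add: algebra_simps)
    thus ?thesis unfolding F1n F2n by (simp add: algebra_simps power2_eq_square)
  qed
  have "fps_nth F k = hyp_coeff A B C k" for k
  proof (induction k)
    case 0
    have "fps_nth F 0 = f 0" using F by (metis eval_fps_at_0 has_fps_expansion_imp_0_eq_fps_nth_0)
    thus ?case using f0 by (simp add: hyp_coeff_def)
  next
    case (Suc k)
    have "of_nat (Suc k) * (C + of_nat k) \<noteq> 0"
      using C by (metis mult_eq_0_iff of_nat_neq_0 plus_of_nat_eq_0_imp)
    thus ?case using rec[of k] hyp_coeff_Suc[OF C, of k A B] Suc by (metis mult_left_cancel)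
  qed
  moreover have "(\<lambda>k. fps_nth F k * z ^ k) sums f z"
    by (rule has_fps_expansion_imp_sums_complex[OF F, of 1]) (use holo z in auto)
  ultimately show ?thesis by simp
qed

text \<open>Frobenius's method at the regular singular point 0: the k-th coefficient of
  \<theta>\<theta> g + p \<theta> g + q g = 0, solved for g_k. With q_0 = 0 the indicial polynomial
  is k (k + p_0), and the exponent 0 allows g_0 = 1.\<close>

fun frobenius_coeff :: "(nat \<Rightarrow> complex) \<Rightarrow> (nat \<Rightarrow> complex) \<Rightarrow> nat \<Rightarrow> complex" where
  "frobenius_coeff p q k = (if k = 0 then 1 else
     - (\<Sum>j<k. (of_nat j * p (k - j) + q (k - j)) * frobenius_coeff p q j) / (of_nat k * (of_nat k + p 0)))"

declare frobenius_coeff.simps [simp del]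

text \<open>The two bounds add up to K j + K (k - j) = K k, so the numerator costs only one power of
  k against the two in the denominator. The quotient k / (k + p_0) is bounded because it tends to
  1.\<close>

lemma frobenius_coeff_bound:
  fixes p q :: "nat \<Rightarrow> complex"
  assumes p: "\<And>m. m > 0 \<Longrightarrow> norm (p m) \<le> K" and q: "\<And>m. m > 0 \<Longrightarrow> norm (q m) \<le> K * m"
    and p0: "\<And>k. k > 0 \<Longrightarrow> of_nat k + p 0 \<noteq> 0"
  obtains L where "L \<ge> 0" "\<And>k. k > 0 \<Longrightarrow>
    norm (frobenius_coeff p q k) \<le> L / k * (\<Sum>j<k. norm (frobenius_coeff p q j))"
proof -
  have K: "K \<ge> 0" using p[of 1] norm_ge_zero[of "p 1"] by (meson order_trans zero_less_one)
  have "(\<lambda>k. 1 / (1 + p 0 / of_nat k)) \<longlonglongrightarrow> 1 / (1 + 0)"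
    by (intro tendsto_intros lim_const_over_n) auto
  hence "Bseq (\<lambda>k. 1 / (1 + p 0 / of_nat k))" by (meson convergentI convergent_imp_Bseq)
  then obtain M where M: "M > 0" "\<And>k. norm (1 / (1 + p 0 / of_nat k)) \<le> M" by (meson BseqE)
  show ?thesis
  proof
    show "M * K \<ge> 0" using M K by simp
    fix k :: nat assume k: "k > 0"
    let ?g = "frobenius_coeff p q"
    have "norm (\<Sum>j<k. (of_nat j * p (k - j) + q (k - j)) * ?g j) \<le> (\<Sum>j<k. K * k * norm (?g j))"
    proof (rule sum_norm_le)
      fix j assume "j \<in> {..<k}"
      hence j: "j < k" by simp
      have "norm (of_nat j * p (k - j) + q (k - j)) \<le> real j * K + K * real (k - j)"
        using p[of "k - j"] q[of "k - j"] j
        by (intro order.trans[OF norm_triangle_ineq] add_mono) (auto simp: norm_mult intro!: mult_left_mono)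
      also have "\<dots> = K * k" using j by (simp add: of_nat_diff algebra_simps)
      finally show "norm ((of_nat j * p (k - j) + q (k - j)) * ?g j) \<le> K * k * norm (?g j)"
        by (simp add: norm_mult mult_right_mono)
    qed
    hence 1: "norm (\<Sum>j<k. (of_nat j * p (k - j) + q (k - j)) * ?g j) \<le> K * k * (\<Sum>j<k. norm (?g j))"
      by (simp add: sum_distrib_left)
    have "?g k = - (1 / (1 + p 0 / of_nat k)) * (\<Sum>j<k. (of_nat j * p (k - j) + q (k - j)) * ?g j) / of_nat k ^ 2"
      using k p0[of k] by (subst frobenius_coeff.simps) (simp add: divide_simps power2_eq_square)
    hence "norm (?g k) = norm (1 / (1 + p 0 / of_nat k)) * norm (\<Sum>j<k. (of_nat j * p (k - j) + q (k - j)) * ?g j) / k ^ 2"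
      by (simp add: norm_mult norm_divide norm_power)
    also have "\<dots> \<le> M * (K * k * (\<Sum>j<k. norm (?g j))) / k ^ 2"
      using M 1 by (intro divide_right_mono mult_mono) auto
    also have "\<dots> = M * K / k * (\<Sum>j<k. norm (?g j))"
      using k by (simp add: power2_eq_square)
    finally show "norm (?g k) \<le> M * K / k * (\<Sum>j<k. norm (?g j))" .
  qed
qed

text \<open>The partial sums S of the norms grow by a factor of at most 1 + L / (k + 1), which tends
  to 1. The ratio test therefore applies to S, which dominates the terms, whereas the terms
  themselves may have no controlled ratio.\<close>

lemma summable_of_partial_sum_bound:
  fixes g :: "nat \<Rightarrow> complex"
  assumes L: "L \<ge> 0" "\<And>k. k > 0 \<Longrightarrow> norm (g k) \<le> L / k * (\<Sum>j<k. norm (g j))" and r: "0 < r" "r < 1"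
  shows "summable (\<lambda>k. g k * of_real r ^ k)"
proof -
  define S where "S = (\<lambda>k. \<Sum>j\<le>k. norm (g j))"
  have S0: "S k \<ge> 0" for k unfolding S_def by (simp add: sum_nonneg)
  have S: "S (Suc k) \<le> (1 + L / Suc k) * S k" for k
    using L(2)[of "Suc k"] unfolding S_def
    by (simp add: lessThan_Suc_atMost algebra_simps)
  define c where "c = (1 + r) / 2"
  have c: "r < c" "c < 1" using r unfolding c_def by auto
  have "(\<lambda>k. (1 + L / real (Suc k)) * r) \<longlonglongrightarrow> (1 + 0) * r"
    by (intro tendsto_intros LIMSEQ_Suc[OF lim_const_over_n])
  hence "eventually (\<lambda>k. (1 + L / real (Suc k)) * r < c) sequentially"
    using c by (simp add: order_tendstoD)
  then obtain N where N: "\<And>k. k \<ge> N \<Longrightarrow> (1 + L / real (Suc k)) * r < c"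
    unfolding eventually_sequentially by blast
  have "summable (\<lambda>k. S k * r ^ k)"
  proof (rule summable_ratio_test[of c N])
    fix k assume k: "N \<le> k"
    have "S (Suc k) * r ^ Suc k \<le> ((1 + L / Suc k) * S k) * r ^ Suc k"
      using S r by (intro mult_right_mono) auto
    also have "\<dots> = ((1 + L / Suc k) * r) * (S k * r ^ k)" by simp
    also have "\<dots> \<le> c * (S k * r ^ k)"
      using N[OF k] S0[of k] r by (intro mult_right_mono) auto
    finally show "norm (S (Suc k) * r ^ Suc k) \<le> c * norm (S k * r ^ k)"
      using S0[of k] S0[of "Suc k"] r by (simp add: abs_mult)
  qed (use c in auto)
  thus ?thesis
  proof (rule summable_comparison_test'[of _ 0])
    fix k :: nat
    have "norm (g k) \<le> S k" unfolding S_def by (rule member_le_sum) auto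
    thus "norm (g k * of_real r ^ k) \<le> S k * r ^ k"
      using r by (simp add: norm_mult norm_power mult_right_mono)
  qed
qed

text \<open>Solving term by term after division by the leading coefficient keeps all
  coefficient bounds linear, which is what gives the full radius of convergence.\<close>

lemma frobenius_solution:
  fixes p q :: "complex fps"
  assumes p: "\<And>m. m > 0 \<Longrightarrow> norm (fps_nth p m) \<le> K" and q: "\<And>m. m > 0 \<Longrightarrow> norm (fps_nth q m) \<le> K * m"
    and q0: "fps_nth q 0 = 0"
    and p0: "\<And>k. k > 0 \<Longrightarrow> of_nat k + fps_nth p 0 \<noteq> 0"
  obtains g where "fps_nth g 0 = 1" "fps_conv_radius g \<ge> 1"
    "fps_X * fps_deriv (fps_X * fps_deriv g) + p * (fps_X * fps_deriv g) + q * g = 0"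
proof
  let ?c = "frobenius_coeff (fps_nth p) (fps_nth q)"
  define g where "g = Abs_fps ?c"
  show "fps_nth g 0 = 1" by (simp add: g_def frobenius_coeff.simps)
  obtain L where L: "L \<ge> 0" "\<And>k. k > 0 \<Longrightarrow> norm (?c k) \<le> L / k * (\<Sum>j<k. norm (?c j))"
    using frobenius_coeff_bound[of "fps_nth p" K "fps_nth q", OF p q p0] by blast
  show "fps_conv_radius g \<ge> 1"
    unfolding fps_conv_radius_def
    using summable_of_partial_sum_bound[OF L] by (intro conv_radius_geI_ex') (auto simp: g_def)
  define E where "E = fps_X * fps_deriv g"
  have En: "fps_nth E k = of_nat k * ?c k" for k
    unfolding E_def g_def by (cases k) auto
  have E2n: "fps_nth (fps_X * fps_deriv E) k = of_nat k ^ 2 * ?c k" for k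
    using En by (cases k) (auto simp: power2_eq_square)
  have "fps_nth (fps_X * fps_deriv E + p * E + q * g) k = 0" for k
  proof (cases "k = 0")
    case True
    thus ?thesis using q0 by (simp add: fps_mult_nth En)
  next
    case False
    have "fps_nth (E * p + g * q) k = (\<Sum>j\<le>k. (of_nat j * fps_nth p (k - j) + fps_nth q (k - j)) * ?c j)"
      by (simp only: fps_add_nth fps_mult_nth En) (simp add: g_def sum.distrib algebra_simps atLeast0AtMost)
    also have "\<dots> = (\<Sum>j<k. (of_nat j * fps_nth p (k - j) + fps_nth q (k - j)) * ?c j)
        + of_nat k * fps_nth p 0 * ?c k"
      by (simp add: lessThan_Suc_atMost[symmetric] q0)
    also have "(\<Sum>j<k. (of_nat j * fps_nth p (k - j) + fps_nth q (k - j)) * ?c j)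
        = - ?c k * (of_nat k * (of_nat k + fps_nth p 0))"
      using False p0[of k] by (subst (2) frobenius_coeff.simps) simp
    finally have "fps_nth (E * p + g * q) k = - (of_nat k ^ 2 * ?c k)"
      by (simp add: algebra_simps power2_eq_square)
    moreover have "fps_nth (fps_X * fps_deriv E + p * E + q * g) k
        = fps_nth (fps_X * fps_deriv E) k + fps_nth (E * p + g * q) k"
      by (simp only: fps_add_nth add.assoc mult.commute[of p E] mult.commute[of q g])
    ultimately show ?thesis unfolding E2n by simp
  qed
  thus "fps_X * fps_deriv (fps_X * fps_deriv g) + p * (fps_X * fps_deriv g) + q * g = 0"
    unfolding E_def fps_eq_iff by simp
qed

section \<open>Analytic continuation to the slit plane\<close>

lemma open_slit_plane: "open slit_plane"
proof -
  have "closed (complex_of_real ` {1..})"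
    by (intro closed_injective_linear_image) (auto simp: inj_on_def linear_iff scaleR_conv_of_real)
  thus ?thesis unfolding slit_plane_def by (simp add: open_closed)
qed

lemma slit_plane_iff: "z \<in> slit_plane \<longleftrightarrow> 1 - z \<notin> \<real>\<^sub>\<le>\<^sub>0"
proof -
  have "z \<in> complex_of_real ` {1..} \<longleftrightarrow> 1 - z \<in> \<real>\<^sub>\<le>\<^sub>0"
  proof
    assume "z \<in> complex_of_real ` {1..}"
    thus "1 - z \<in> \<real>\<^sub>\<le>\<^sub>0" by (auto simp: complex_nonpos_Reals_iff)
  next
    assume "1 - z \<in> \<real>\<^sub>\<le>\<^sub>0"
    then obtain r where r: "r \<le> 0" "1 - z = of_real r" by (auto elim!: nonpos_Reals_cases)
    hence "z = of_real (1 - r)" by (simp add: algebra_simps)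
    thus "z \<in> complex_of_real ` {1..}" using r(1) by (intro image_eqI[of _ _ "1 - r"]) auto
  qed
  thus ?thesis unfolding slit_plane_def by auto
qed

lemma slit_plane_if_Re_less: "Re z < 1 \<Longrightarrow> z \<in> slit_plane"
  unfolding slit_plane_iff by (auto simp: complex_nonpos_Reals_iff)

lemma ball_subset_slit_plane: "ball 0 1 \<subseteq> slit_plane"
proof
  fix z :: complex assume "z \<in> ball 0 1"
  thus "z \<in> slit_plane"
    using complex_Re_le_cmod[of z] by (intro slit_plane_if_Re_less) auto
qed

lemma connected_slit_plane: "connected slit_plane"
proof (rule starlike_imp_connected)
  show "starlike slit_plane"
    unfolding starlike_def
  proof (intro bexI ballI subsetI)
    show "(0::complex) \<in> slit_plane" using ball_subset_slit_plane by auto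
    fix x y :: complex assume x: "x \<in> slit_plane" and "y \<in> closed_segment 0 x"
    then obtain u where u: "0 \<le> u" "u \<le> 1" "y = of_real u * x"
      by (auto simp: closed_segment_def scaleR_conv_of_real)
    show "y \<in> slit_plane"
    proof (rule ccontr)
      assume "y \<notin> slit_plane"
      then obtain r where r: "r \<ge> 1" "y = of_real r" unfolding slit_plane_def by auto
      have "u \<noteq> 0" using u r by auto
      hence "x = of_real (r / u)" using u r by (simp add: field_simps)
      moreover have "r / u \<in> {1..}" using u r \<open>u \<noteq> 0\<close> by (simp add: field_simps)
      ultimately have "x \<in> complex_of_real ` {1..}" by blast
      thus False using x unfolding slit_plane_def by simp
    qed
  qed
qed

text \<open>The inverse of the Koebe-type map w \<mapsto> 4w / (1 + w)^2: s = sqrt (1 - z) carries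
  the slit plane to the right half-plane, and the Cayley map (1 - s) / (1 + s) carries that to the
  unit disk.\<close>

definition slit_to_disk :: "complex \<Rightarrow> complex" where
  "slit_to_disk z = (1 - csqrt (1 - z)) / (1 + csqrt (1 - z))"

lemma slit_csqrt_Re_pos:
  assumes "z \<in> slit_plane" shows "Re (csqrt (1 - z)) > 0"
proof (rule ccontr)
  assume "\<not> ?thesis"
  hence "Re (csqrt (1 - z)) = 0" using csqrt_principal[of "1 - z"] by auto
  hence "csqrt (1 - z) = \<i> * of_real (Im (csqrt (1 - z)))" by (simp add: complex_eq_iff)
  hence "1 - z = (\<i> * of_real (Im (csqrt (1 - z)))) ^ 2" by (metis power2_csqrt)
  also have "\<dots> = of_real (- (Im (csqrt (1 - z)) ^ 2))" by (simp add: power_mult_distrib)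
  also have "\<dots> \<in> \<real>\<^sub>\<le>\<^sub>0" by (simp only: nonpos_Reals_of_real_iff) simp
  finally show False using assms unfolding slit_plane_iff by simp
qed

lemma has_field_derivative_slit_csqrt:
  assumes "z \<in> slit_plane"
  shows "((\<lambda>z. csqrt (1 - z)) has_field_derivative - 1 / (2 * csqrt (1 - z))) (at z)"
proof -
  have "((\<lambda>z. csqrt (1 - z)) has_field_derivative (0 - 1) / (2 * csqrt (1 - z))) (at z)"
    by (rule has_field_derivative_csqrt'; (intro derivative_intros)?) (use assms[unfolded slit_plane_iff] in auto)
  thus ?thesis by simp
qed

lemma slit_to_disk_in_ball:
  assumes "z \<in> slit_plane" shows "slit_to_disk z \<in> ball 0 1"
proof -
  define s where "s = csqrt (1 - z)"
  have s: "Re s > 0" unfolding s_def using assms by (rule slit_csqrt_Re_pos)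
  have "cmod (1 - s) < cmod (1 + s)"
    unfolding cmod_def using s by (intro real_sqrt_less_mono) (simp add: power2_eq_square algebra_simps)
  moreover have "1 + s \<noteq> 0" using s by (auto simp: complex_eq_iff)
  ultimately show ?thesis unfolding slit_to_disk_def s_def[symmetric] by (simp add: norm_divide divide_simps)
qed

text \<open>Needed for the second Euler derivative of a pulled-back function: the first one already
  carries the factor 1 / s, where s = sqrt (1 - z).\<close>

lemma euler_deriv_on_slit_csqrt_inverse:
  "euler_deriv_on (\<lambda>z. 1 / csqrt (1 - z)) (\<lambda>z. z / (2 * csqrt (1 - z) ^ 3)) slit_plane"
  unfolding euler_deriv_on_def
proof
  fix z assume z: "z \<in> slit_plane"
  define s where "s = csqrt (1 - z)"
  have s: "Re s > 0" unfolding s_def using z by (rule slit_csqrt_Re_pos)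
  hence s0: "s \<noteq> 0" by auto
  show "\<exists>D. ((\<lambda>z. 1 / csqrt (1 - z)) has_field_derivative D) (at z) \<and> z / (2 * csqrt (1 - z) ^ 3) = z * D"
  proof (intro exI conjI)
    show "((\<lambda>z. 1 / csqrt (1 - z)) has_field_derivative 1 / (2 * s ^ 3)) (at z)"
      using DERIV_divide[OF DERIV_const[of 1] has_field_derivative_slit_csqrt[OF z]] s0
      by (simp add: power3_eq_cube mult_ac flip: s_def)
  qed (simp add: s_def)
qed

lemma euler_deriv_on_slit_to_disk:
  "euler_deriv_on slit_to_disk (\<lambda>z. slit_to_disk z * (1 / csqrt (1 - z))) slit_plane"
  unfolding euler_deriv_on_def
proof
  fix z assume z: "z \<in> slit_plane"
  define s where "s = csqrt (1 - z)"
  have s: "Re s > 0" unfolding s_def using z by (rule slit_csqrt_Re_pos)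
  hence s0: "s \<noteq> 0" "1 + s \<noteq> 0" by (auto simp: complex_eq_iff)
  have zs: "z = 1 - s ^ 2" unfolding s_def by simp
  show "\<exists>D. (slit_to_disk has_field_derivative D) (at z) \<and> slit_to_disk z * (1 / csqrt (1 - z)) = z * D"
  proof (intro exI conjI)
    show "(slit_to_disk has_field_derivative 1 / (s * (1 + s) ^ 2)) (at z)"
      using DERIV_divide[OF DERIV_diff[OF DERIV_const[of 1] has_field_derivative_slit_csqrt[OF z]]
        DERIV_add[OF DERIV_const[of 1] has_field_derivative_slit_csqrt[OF z]]] s0
      unfolding slit_to_disk_def [abs_def] s_def [symmetric]
      by (simp add: divide_simps power2_eq_square flip: s_def)
    show "slit_to_disk z * (1 / csqrt (1 - z)) = z * (1 / (s * (1 + s)\<^sup>2))"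
      unfolding slit_to_disk_def s_def[symmetric] using s0
      by (subst zs) (simp add: divide_simps power2_eq_square, simp add: algebra_simps)
  qed
qed

text \<open>The map \<open>z = 4w / (1 + w)\<^sup>2\<close> pulls the hypergeometric equation on the slit plane
  back to an equation on the unit disk whose only singularity there is \<open>w = 0\<close>.\<close>

lemma ex_hyp_solution_slit_plane:
  assumes C: "C \<notin> \<int>\<^sub>\<le>\<^sub>0"
  shows "\<exists>f. hyp_solution A B C f slit_plane"
proof -
  \<comment> \<open>Taylor coefficients of the pulled-back equation \<theta>\<theta> g + p \<theta>
    g + q g = 0 in w, where p = (C - 1) (1 + w) / (1 - w) + (1 - 2 (A + B)) 2w / (1 - w^2) and q = -
    4 A B w / (1 + w)^2. Simple poles at 1 and -1 keep the coefficients of p bounded; the double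
    pole of q makes its coefficients grow linearly.\<close>
  define p where "p = Abs_fps (\<lambda>m. if m = 0 then C - 1 else
      (1 - (-1) ^ m) * (1 - 2 * (A + B)) + 2 * (C - 1))"
  define q where "q = Abs_fps (\<lambda>m. 4 * A * B * of_nat m * (-1) ^ m)"
  define K where "K = 2 * norm (1 - 2 * (A + B)) + 2 * norm (C - 1) + 4 * norm A * norm B"
  have bp: "norm (fps_nth p m) \<le> K" if "m > 0" for m
  proof -
    have "norm (1 - (-1) ^ m :: complex) \<le> 2"
      by (cases "even m") auto
    hence "norm ((1 - (-1) ^ m) * (1 - 2 * (A + B))) \<le> 2 * norm (1 - 2 * (A + B))"
      by (simp only: norm_mult mult_right_mono norm_ge_zero)
    moreover have "norm (2 * (C - 1)) = 2 * norm (C - 1)" by (simp only: norm_mult norm_numeral)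
    ultimately have "norm ((1 - (-1) ^ m) * (1 - 2 * (A + B)) + 2 * (C - 1))
      \<le> 2 * norm (1 - 2 * (A + B)) + 2 * norm (C - 1)"
      by (intro order.trans[OF norm_triangle_ineq] add_mono) auto
    also have "\<dots> \<le> K" unfolding K_def by simp
    finally show ?thesis using that by (simp add: p_def)
  qed
  have bq: "norm (fps_nth q m) \<le> K * m" if "m > 0" for m
  proof -
    have "norm (fps_nth q m) = 4 * norm A * norm B * m"
      by (simp add: q_def norm_mult norm_power)
    also have "\<dots> \<le> K * m" unfolding K_def by (intro mult_right_mono) auto
    finally show ?thesis .
  qed
  have "of_nat k + fps_nth p 0 \<noteq> 0" if "k > 0" for k
    using that C plus_of_nat_eq_0_imp[of C "k - 1"] by (auto simp: p_def of_nat_diff algebra_simps)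
  then obtain g where g: "fps_nth g 0 = 1" "fps_conv_radius g \<ge> 1"
    and eq: "fps_X * fps_deriv (fps_X * fps_deriv g) + p * (fps_X * fps_deriv g) + q * g = 0"
    using frobenius_solution[of p K q] bp bq by (auto simp: q_def)
  define g1 where "g1 = fps_X * fps_deriv g"
  define g2 where "g2 = fps_X * fps_deriv g1"
  have radE: "fps_conv_radius (fps_X * fps_deriv f) \<ge> 1" if "fps_conv_radius f \<ge> 1" for f :: "complex fps"
    using fps_conv_radius_mult[of fps_X "fps_deriv f"] fps_conv_radius_deriv[of f] that
    by (auto simp: min_def split: if_splits)
  have r1: "fps_conv_radius g1 \<ge> 1" unfolding g1_def using g(2) by (rule radE)
  have r2: "fps_conv_radius g2 \<ge> 1" unfolding g2_def using r1 by (rule radE)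
  have ed: "euler_deriv_on (eval_fps f) (eval_fps (fps_X * fps_deriv f)) (ball 0 1)"
    if "fps_conv_radius f \<ge> 1" for f
    unfolding euler_deriv_on_def
  proof
    fix w :: complex assume "w \<in> ball 0 1"
    hence "ereal (norm w) < 1" by simp
    hence w: "ereal (norm w) < fps_conv_radius f" using that by (rule less_le_trans)
    moreover have "ereal (norm w) < fps_conv_radius (fps_deriv f)"
      using w fps_conv_radius_deriv[of f] by (rule less_le_trans)
    ultimately show "\<exists>D. (eval_fps f has_field_derivative D) (at w) \<and> eval_fps (fps_X * fps_deriv f) w = w * D"
      by (intro exI[of _ "eval_fps (fps_deriv f) w"] conjI has_field_derivative_eval_fps)
         (auto simp: eval_fps_mult)
  qed
  have sp: "(\<lambda>m. fps_nth p m * w ^ m) sums (C - 1 + 2 * w / ((1 - w) * (1 + w)) * (1 - 2 * (A + B)) + 2 * (C - 1) * (w / (1 - w)))"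
    if w: "norm w < 1" for w
  proof -
    have w1: "1 - w \<noteq> 0" "1 + w \<noteq> 0" using w by (auto simp: add_eq_0_iff)
    have "(\<lambda>m. w ^ m) sums (1 / (1 - w))" "(\<lambda>m. (- w) ^ m) sums (1 / (1 - (- w)))"
      using w by (intro geometric_sums; simp)+
    moreover have "(\<lambda>m. if m = 0 then c else (0::complex)) sums c" for c
      by (rule sums_single)
    ultimately have "(\<lambda>m. (if m = 0 then C - 1 else 0) + (w ^ m - (- w) ^ m) * (1 - 2 * (A + B))
       + 2 * (C - 1) * (w ^ m - (if m = 0 then 1 else 0))) sums
       ((C - 1) + (1 / (1 - w) - 1 / (1 - (- w))) * (1 - 2 * (A + B)) + 2 * (C - 1) * (1 / (1 - w) - 1))"
      by (intro sums_add sums_diff sums_mult sums_mult2)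
    also have "(\<lambda>m. (if m = 0 then C - 1 else 0) + (w ^ m - (- w) ^ m) * (1 - 2 * (A + B))
       + 2 * (C - 1) * (w ^ m - (if m = 0 then 1 else 0))) = (\<lambda>m. fps_nth p m * w ^ m)"
      by (auto simp: fun_eq_iff p_def power_minus[of w] algebra_simps)
    also have "(1 / (1 - w) - 1 / (1 - (- w))) = 2 * w / ((1 - w) * (1 + w))"
      using w1 by (simp add: field_simps)
    also have "1 / (1 - w) - 1 = w / (1 - w)"
      using w1 by (simp add: field_simps)
    finally show ?thesis .
  qed
  have sq: "(\<lambda>m. fps_nth q m * w ^ m) sums (4 * A * B * (- w / (1 + w) ^ 2))"
    if w: "norm w < 1" for w
  proof -
    have "(\<lambda>m. of_nat (Suc m) * (- w) ^ m * (- w)) sums (1 / (1 - (- w)) ^ 2 * (- w))"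
      using w by (intro sums_mult2 geometric_deriv_sums) auto
    hence "(\<lambda>m. of_nat (Suc m) * (- w) ^ Suc m) sums (- w / (1 + w) ^ 2)"
      by (simp add: mult_ac)
    hence "(\<lambda>m. of_nat m * (- w) ^ m) sums (- w / (1 + w) ^ 2)"
      by (subst (asm) sums_Suc_iff) simp
    from sums_mult[OF this, of "4 * A * B"] show ?thesis
      by (simp add: q_def power_minus[of w] mult_ac)
  qed
  have radpq: "fps_conv_radius p \<ge> 1" "fps_conv_radius q \<ge> 1"
  proof -
    show "fps_conv_radius p \<ge> 1" unfolding fps_conv_radius_def
      by (rule conv_radius_geI_ex') (use sp sums_summable in force)
    show "fps_conv_radius q \<ge> 1" unfolding fps_conv_radius_def
      by (rule conv_radius_geI_ex') (use sq sums_summable in force)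
  qed
  have weq: "eval_fps g2 w + (C - 1 + 2 * w / ((1 - w) * (1 + w)) * (1 - 2 * (A + B)) + 2 * (C - 1) * (w / (1 - w))) * eval_fps g1 w
     + 4 * A * B * (- w / (1 + w) ^ 2) * eval_fps g w = 0" if w: "norm w < 1" for w
  proof -
    have w': "ereal (norm w) < 1" using w by simp
    have rad: "ereal (norm w) < fps_conv_radius f" if "fps_conv_radius f \<ge> 1" for f :: "complex fps"
      using w' that by (rule less_le_trans)
    have radm: "ereal (norm w) < fps_conv_radius (f * h)"
      if "fps_conv_radius f \<ge> 1" "fps_conv_radius h \<ge> 1" for f h :: "complex fps"
      by (rule less_le_trans[OF w' order.trans[OF _ fps_conv_radius_mult]]) (use that in auto)
    have rada: "ereal (norm w) < fps_conv_radius (g2 + p * g1)"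
      by (rule less_le_trans[OF _ fps_conv_radius_add]) (use rad[OF r2] radm[OF radpq(1) r1] in auto)
    have "eval_fps (g2 + p * g1 + q * g) w = 0"
      using eq unfolding g2_def g1_def by simp
    hence "eval_fps g2 w + eval_fps p w * eval_fps g1 w + eval_fps q w * eval_fps g w = 0"
      using rad[OF r2] rad[OF r1] rad[OF g(2)] rad[OF radpq(1)] rad[OF radpq(2)] rada
        radm[OF radpq(1) r1] radm[OF radpq(2) g(2)]
      by (simp add: eval_fps_add eval_fps_mult)
    moreover have "eval_fps p w = C - 1 + 2 * w / ((1 - w) * (1 + w)) * (1 - 2 * (A + B)) + 2 * (C - 1) * (w / (1 - w))"
      unfolding eval_fps_def using sp[OF w] by (simp add: sums_iff)
    moreover have "eval_fps q w = 4 * A * B * (- w / (1 + w) ^ 2)"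
      unfolding eval_fps_def using sq[OF w] by (simp add: sums_iff)
    ultimately show ?thesis by simp
  qed
  define f where "f = (\<lambda>z. eval_fps g (slit_to_disk z))"
  define T where "T = (\<lambda>z. 1 / csqrt (1 - z) * eval_fps g1 (slit_to_disk z))"
  define U where "U = (\<lambda>z. z / (2 * csqrt (1 - z) ^ 3) * eval_fps g1 (slit_to_disk z)
     + 1 / csqrt (1 - z) * (1 / csqrt (1 - z) * eval_fps g2 (slit_to_disk z)))"
  have comp: "euler_deriv_on (\<lambda>z. eval_fps h (slit_to_disk z))
      (\<lambda>z. 1 / csqrt (1 - z) * eval_fps (fps_X * fps_deriv h) (slit_to_disk z)) slit_plane"
    if "fps_conv_radius h \<ge> 1" for h
    by (rule euler_deriv_on_compose[OF ed euler_deriv_on_slit_to_disk]) (use that slit_to_disk_in_ball in auto)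
  have "euler_deriv_on f T slit_plane"
    unfolding f_def T_def g1_def by (rule comp) (rule g(2))
  moreover have "euler_deriv_on T U slit_plane"
    unfolding T_def U_def
    by (rule euler_deriv_on_mult[OF euler_deriv_on_slit_csqrt_inverse comp[OF r1, folded g2_def]])
  moreover have "(1 - z) * U z + (C - 1 - (A + B) * z) * T z - A * B * z * f z = 0"
    if z: "z \<in> slit_plane" for z
  proof -
    \<comment> \<open>Both variables are rational in s, namely z = 1 - s^2 and w = (1 - s) / (1 +
      s), so the transfer between the two equations becomes a rational identity in s.\<close>
    define s where "s = csqrt (1 - z)"
    define w where "w = slit_to_disk z"
    have s: "Re s > 0" unfolding s_def using z by (rule slit_csqrt_Re_pos)
    hence s0: "s \<noteq> 0" "1 + s \<noteq> 0" by (auto simp: complex_eq_iff)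
    have zs: "z = 1 - s ^ 2" unfolding s_def by simp
    have ws: "w = (1 - s) / (1 + s)" unfolding w_def slit_to_disk_def s_def ..
    have w: "norm w < 1" using slit_to_disk_in_ball[OF z] unfolding w_def by simp
    have w1: "1 - w = 2 * s / (1 + s)" "1 + w = 2 / (1 + s)"
      unfolding ws using s0 by (auto simp: field_simps)
    have e1: "2 * w / ((1 - w) * (1 + w)) = (1 - s ^ 2) / (2 * s)"
      unfolding w1 unfolding ws using s0 by (simp add: divide_simps power2_eq_square) (simp add: algebra_simps)
    have e2: "w / (1 - w) = (1 - s) / (2 * s)"
      unfolding w1 unfolding ws using s0 by (simp add: divide_simps)
    have e3: "- w / (1 + w) ^ 2 = - (1 - s ^ 2) / 4"
      unfolding w1 unfolding ws using s0 by (simp add: divide_simps power2_eq_square) (simp add: algebra_simps)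
    define G where "G = eval_fps g w"
    define G1 where "G1 = eval_fps g1 w"
    define G2 where "G2 = eval_fps g2 w"
    have weq': "G2 = - (C - 1 + (1 - s ^ 2) / (2 * s) * (1 - 2 * (A + B)) + 2 * (C - 1) * ((1 - s) / (2 * s))) * G1
       - 4 * A * B * (- (1 - s ^ 2) / 4) * G"
      using weq[OF w] unfolding e1 e2 e3 G_def G1_def G2_def by (simp add: algebra_simps)
    have UTf: "U z = (1 - s ^ 2) / (2 * s ^ 3) * G1 + 1 / s * (1 / s * G2)" "T z = 1 / s * G1" "f z = G"
      using zs unfolding U_def T_def f_def G_def G1_def G2_def w_def s_def[symmetric] by simp_all
    have "s ^ 2 * ((1 - s ^ 2) / (2 * s ^ 3) * G1 + 1 / s * (1 / s * G2)) = (1 - s ^ 2) / (2 * s) * G1 + G2"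
      using s0(1) by (simp add: field_simps power2_eq_square power3_eq_cube)
    also have "\<dots> = - (C - 1 - (A + B) * (1 - s ^ 2)) * (1 / s * G1) + A * B * (1 - s ^ 2) * G"
      unfolding weq' using s0(1) by (simp add: divide_simps power2_eq_square) (simp add: algebra_simps)
    finally have eqs: "s ^ 2 * U z = - (C - 1 - (A + B) * (1 - s ^ 2)) * T z + A * B * (1 - s ^ 2) * f z"
      unfolding UTf .
    have s2: "s ^ 2 = 1 - z" using zs by simp
    show ?thesis using eqs unfolding s2 by (simp add: algebra_simps)
  qed
  moreover have "f 0 = 1"
    unfolding f_def slit_to_disk_def using g(1) by (simp add: eval_fps_at_0)
  ultimately show ?thesis unfolding hyp_solution_def by blast
qed

section \<open>Identification with \<open>hyp2F1\<close> and Pfaff's transformation\<close>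

lemma hyp_solution_subset: "hyp_solution A B C f S \<Longrightarrow> S' \<subseteq> S \<Longrightarrow> hyp_solution A B C f S'"
  unfolding hyp_solution_def euler_deriv_on_def by blast

lemma hyp_solution_imp_holomorphic: "hyp_solution A B C f S \<Longrightarrow> f holomorphic_on S"
  unfolding hyp_solution_def using euler_deriv_on_imp_holomorphic by blast

text \<open>A solution is a witness for the \<open>SOME\<close>, so the chosen function has the
  defining property; both then agree on the unit disk and, by the identity theorem, on the connected
  slit plane.\<close>

lemma hyp2F1_eq_hyp_solution:
  assumes C: "C \<notin> \<int>\<^sub>\<le>\<^sub>0" and f: "hyp_solution A B C f slit_plane" and z: "z \<in> slit_plane"
  shows "hyp2F1 A B C z = f z"
proof -
  let ?P = "\<lambda>F. F holomorphic_on slit_plane \<and> (\<forall>z\<in>ball 0 1.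
        (\<lambda>k. pochhammer A k * pochhammer B k / (pochhammer C k * fact k) * z ^ k) sums F z)"
  have f': "?P f"
    using hyp_solution_imp_holomorphic[OF f]
      hyp_solution_sums[OF hyp_solution_subset[OF f ball_subset_slit_plane] C]
    unfolding hyp_coeff_def by auto
  hence F: "?P (hyp2F1 A B C)" unfolding hyp2F1_def by (rule someI[of ?P])
  show ?thesis
  proof (rule analytic_continuation_open[of "ball 0 1" slit_plane "hyp2F1 A B C" f])
    show "hyp2F1 A B C w = f w" if "w \<in> ball 0 1" for w
      using f' F that sums_unique2 by blast
  qed (use open_slit_plane connected_slit_plane ball_subset_slit_plane f' F z in auto)
qed

text \<open>With \<open>f\<close> the continuation, \<open>(1 - y) powr (- B) * f (y / (y - 1))\<close> solves the hypergeometric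
  equation for \<open>C - A, B, C\<close> on the unit disk (Pfaff), and \<open>y = 1/2\<close> gives the value at -1.\<close>

lemma hyp2F1_minus_one:
  assumes C: "C \<notin> \<int>\<^sub>\<le>\<^sub>0"
  shows "(\<lambda>k. hyp_coeff (C - A) B C k * (1 / 2) ^ k) sums (2 powr B * hyp2F1 A B C (-1))"
proof -
  obtain f where f: "hyp_solution A B C f slit_plane" using ex_hyp_solution_slit_plane[OF C] by blast
  obtain T U where TU: "euler_deriv_on f T slit_plane" "euler_deriv_on T U slit_plane"
    and eq: "\<And>z. z \<in> slit_plane \<Longrightarrow> (1 - z) * U z + (C - 1 - (A + B) * z) * T z - A * B * z * f z = 0"
    and f0: "f 0 = 1"
    using f unfolding hyp_solution_def by metis
  define \<phi> where "\<phi> = (\<lambda>y::complex. y / (y - 1))"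
  \<comment> \<open>\<open>m\<close> is the factor that \<open>\<phi>\<close> contributes to the
    chain rule, and everything else is expressed by it: \<phi> = 1 - m, y = 1 - 1 / m, \<theta> m =
    m^2 - m and \<theta> v = B (m - 1) v. Pfaff's transformation thereby reduces to the rational
    identity \<open>key\<close>.\<close>
  define m where "m = (\<lambda>y::complex. 1 / (1 - y))"
  define v where "v = (\<lambda>y::complex. (1 - y) powr (- B))"
  have y1: "1 - y \<noteq> 0" "Re y < 1" if "y \<in> ball 0 1" for y :: complex
    using that complex_Re_le_cmod[of y] by auto
  have \<phi>S: "\<phi> y \<in> slit_plane" if y: "y \<in> ball 0 1" for y
  proof -
    have "1 - \<phi> y = 1 / (1 - y)" using y1[OF y] unfolding \<phi>_def by (simp add: divide_simps)
    moreover have "1 / (1 - y) \<notin> \<real>\<^sub>\<le>\<^sub>0"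
    proof
      assume "1 / (1 - y) \<in> \<real>\<^sub>\<le>\<^sub>0"
      then obtain r where r: "r \<le> 0" "1 / (1 - y) = of_real r" by (auto elim!: nonpos_Reals_cases)
      have "1 - y = 1 / (1 / (1 - y))" by simp
      also have "\<dots> = of_real (1 / r)" unfolding r(2) by simp
      finally have "1 - y = of_real (1 / r)" .
      hence "Re (1 - y) = 1 / r" by (simp only: Re_complex_of_real)
      thus False using r y1[OF y] by (smt (verit) minus_complex.sel(1) one_complex.sel(1) divide_nonneg_nonpos)
    qed
    ultimately show ?thesis unfolding slit_plane_iff by simp
  qed
  have ed\<phi>: "euler_deriv_on \<phi> (\<lambda>y. \<phi> y * m y) (ball 0 1)"
    unfolding euler_deriv_on_def
  proof
    fix y :: complex assume y: "y \<in> ball 0 1"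
    have "y - 1 \<noteq> 0" using y1[OF y] by auto
    thus "\<exists>D. (\<phi> has_field_derivative D) (at y) \<and> \<phi> y * m y = y * D"
      using y1[OF y] unfolding \<phi>_def m_def
      by (intro exI[of _ "- 1 / (y - 1) ^ 2"] conjI)
         (auto intro!: derivative_eq_intros simp: divide_simps power2_eq_square, simp_all add: algebra_simps)
  qed
  have edm: "euler_deriv_on m (\<lambda>y. m y ^ 2 - m y) (ball 0 1)"
    unfolding euler_deriv_on_def
  proof
    fix y :: complex assume y: "y \<in> ball 0 1"
    show "\<exists>D. (m has_field_derivative D) (at y) \<and> m y ^ 2 - m y = y * D"
      using y1[OF y] unfolding m_def
      by (intro exI[of _ "1 / (1 - y) ^ 2"] conjI)
         (auto intro!: derivative_eq_intros simp: divide_simps power2_eq_square)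
  qed
  \<comment> \<open>The sum with -1 matches the form that \<open>euler_deriv_on_add\<close> yields
    with a constant from \<open>edc\<close>, so that the second derivative can be composed from the
    rules.\<close>
  have edv: "euler_deriv_on v (\<lambda>y. B * (m y + (-1)) * v y) (ball 0 1)"
    unfolding euler_deriv_on_def
  proof
    fix y :: complex assume y: "y \<in> ball 0 1"
    have "1 - y \<notin> \<real>\<^sub>\<le>\<^sub>0" using y1[OF y] by (auto simp: complex_nonpos_Reals_iff)
    thus "\<exists>D. (v has_field_derivative D) (at y) \<and> B * (m y + (-1)) * v y = y * D"
      using y1[OF y] unfolding v_def m_def
      by (intro exI[of _ "B * (1 - y) powr (- B - 1)"] conjI)
         (auto intro!: derivative_eq_intros simp: divide_simps powr_diff)
  qed
  have edc: "euler_deriv_on (\<lambda>y. c) (\<lambda>y. 0) (ball 0 1)" for c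
    unfolding euler_deriv_on_def by (auto intro!: exI[of _ 0])
  define h where "h = (\<lambda>y. v y * f (\<phi> y))"
  note comp = euler_deriv_on_compose[OF _ ed\<phi> \<phi>S]
  note ed1 = euler_deriv_on_mult[OF edv comp[OF TU(1)]]
  note ed2 = euler_deriv_on_add[OF
     euler_deriv_on_mult[OF euler_deriv_on_mult[OF euler_deriv_on_mult[OF edc euler_deriv_on_add[OF edm edc]] edv] comp[OF TU(1)]]
     euler_deriv_on_mult[OF edv euler_deriv_on_mult[OF edm comp[OF TU(2)]]], of B "-1"]
  have "hyp_solution (C - A) B C h (ball 0 1)"
    unfolding hyp_solution_def
  proof (intro conjI exI ballI)
    show "h 0 = 1" unfolding h_def v_def \<phi>_def using f0 by simp
    show "euler_deriv_on h (\<lambda>y. B * (m y + - 1) * v y * f (\<phi> y) + v y * (m y * T (\<phi> y))) (ball 0 1)"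
      unfolding h_def by (rule ed1)
    show "euler_deriv_on (\<lambda>y. B * (m y + - 1) * v y * f (\<phi> y) + v y * (m y * T (\<phi> y)))
        (\<lambda>y. ((0 * (m y + - 1) + B * ((m y)\<^sup>2 - m y + 0)) * v y + B * (m y + - 1) * (B * (m y + - 1) * v y)) * f (\<phi> y) +
          B * (m y + - 1) * v y * (m y * T (\<phi> y)) +
          (B * (m y + - 1) * v y * (m y * T (\<phi> y)) + v y * (((m y)\<^sup>2 - m y) * T (\<phi> y) + m y * (m y * U (\<phi> y))))) (ball 0 1)"
      by (rule ed2)
    fix y :: complex assume y: "y \<in> ball 0 1"
    have m0: "m y \<noteq> 0" and ym: "1 - y = 1 / m y" and ym': "y = 1 - 1 / m y"
      using y1[OF y] unfolding m_def by auto
    have \<phi>m: "\<phi> y = 1 - m y"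
      using y1[OF y] unfolding m_def \<phi>_def by (simp add: divide_simps) (simp add: algebra_simps)
    have key: "1 / M * (((0 * (M + - 1) + B * (M\<^sup>2 - M + 0)) * V + B * (M + - 1) * (B * (M + - 1) * V)) * F +
          B * (M + - 1) * V * (M * T) +
          (B * (M + - 1) * V * (M * T) + V * ((M\<^sup>2 - M) * T + M * (M * U)))) +
         (C - 1 - (C - A + B) * (1 - 1 / M)) * (B * (M + - 1) * V * F + V * (M * T)) -
         (C - A) * B * (1 - 1 / M) * (V * F) = 0"
      if "M \<noteq> 0" "M * U + (C - 1 - (A + B) * (1 - M)) * T - A * B * (1 - M) * F = 0" for M V F T U
    proof -
      have U: "U = (A * B * (1 - M) * F - (C - 1 - (A + B) * (1 - M)) * T) / M"
        using that by (simp add: field_simps)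
      show ?thesis unfolding U using that(1) by (simp add: divide_simps power2_eq_square) (simp add: algebra_simps)
    qed
    show "(1 - y) * (((0 * (m y + - 1) + B * ((m y)\<^sup>2 - m y + 0)) * v y + B * (m y + - 1) * (B * (m y + - 1) * v y)) * f (\<phi> y) +
          B * (m y + - 1) * v y * (m y * T (\<phi> y)) +
          (B * (m y + - 1) * v y * (m y * T (\<phi> y)) + v y * (((m y)\<^sup>2 - m y) * T (\<phi> y) + m y * (m y * U (\<phi> y))))) +
         (C - 1 - (C - A + B) * y) * (B * (m y + - 1) * v y * f (\<phi> y) + v y * (m y * T (\<phi> y))) -
         (C - A) * B * y * h y = 0"
      using key[OF m0, of "U (\<phi> y)" "T (\<phi> y)" "f (\<phi> y)" "v y"] eq[OF \<phi>S[OF y]]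
      unfolding h_def ym unfolding ym'[symmetric] \<phi>m by simp
  qed
  hence "(\<lambda>k. hyp_coeff (C - A) B C k * (1 / 2) ^ k) sums h (1 / 2)"
    by (rule hyp_solution_sums[OF _ C]) simp
  also have "h (1 / 2) = 2 powr B * f (-1)"
    using Ln_inverse[of 2] unfolding h_def v_def \<phi>_def by (simp add: powr_def inverse_eq_divide)
  also have "f (-1) = hyp2F1 A B C (-1)"
    by (rule hyp2F1_eq_hyp_solution[symmetric, OF C f slit_plane_if_Re_less]) simp
  finally show ?thesis .
qed

section \<open>The coefficients P and Q\<close>

definition fib_weight :: "complex \<Rightarrow> complex \<Rightarrow> nat \<Rightarrow> complex" where
  "fib_weight b e k = (-1/4) ^ k * pochhammer b k / pochhammer e k"

text \<open>With all weights 1 this would be a Fibonacci number. Q is half of such a sum for e = (a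
  + 1) / 2, and P combines two consecutive ones for e = a / 2.\<close>

definition fib_sum :: "complex \<Rightarrow> complex \<Rightarrow> nat \<Rightarrow> complex" where
  "fib_sum b e n = (\<Sum>k\<le>n. of_nat ((n - k) choose k) * fib_weight b e k)"

text \<open>The binomial vanishes for 2k > n. A cutoff that can be chosen freely lets sums for
  different n run over a common range.\<close>

lemma fib_sum_eq:
  assumes "n \<le> 2 * M + 1"
  shows "fib_sum b e n = (\<Sum>k\<le>M. of_nat ((n - k) choose k) * fib_weight b e k)"
proof -
  have z: "(n - k) choose k = 0" if "2 * k > n" for k
    using that by (intro binomial_eq_0) auto
  have "(\<Sum>k\<le>n. of_nat ((n - k) choose k) * fib_weight b e k) = (\<Sum>k\<le>max n M. of_nat ((n - k) choose k) * fib_weight b e k)"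
    by (rule sum.mono_neutral_left) (auto simp: z)
  also have "\<dots> = (\<Sum>k\<le>M. of_nat ((n - k) choose k) * fib_weight b e k)"
    by (rule sum.mono_neutral_right) (use assms in \<open>auto simp: z\<close>)
  finally show ?thesis unfolding fib_sum_def .
qed

lemma of_nat_binomial_absorb_comp: "of_nat x * of_nat ((x - 1) choose k) = (of_nat x - of_nat k) * (of_nat (x choose k) :: complex)"
proof (cases "k \<le> x")
  case True
  have "of_nat ((x - k) * (x choose k)) = (of_nat (x * ((x - 1) choose k)) :: complex)"
    by (simp only: binomial_absorb_comp)
  thus ?thesis using True by (simp add: of_nat_diff)
next
  case False
  thus ?thesis by (simp add: binomial_eq_0)
qed

lemma of_nat_Suc_times_binomial_Suc: "of_nat (Suc k) * of_nat (x choose Suc k) = (of_nat x - of_nat k) * (of_nat (x choose k) :: complex)"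
proof -
  have "of_nat (Suc k * (x choose Suc k)) = (of_nat (x * ((x - 1) choose k)) :: complex)"
    by (simp only: binomial_absorption)
  thus ?thesis by (simp only: of_nat_mult of_nat_binomial_absorb_comp)
qed

text \<open>Creative telescoping: the k-th term D of the combination equals h k - h (k - 1), with
  certificate h, and D 0 = h 0, so the sum collapses to h (m + 2) = 0. The hypothesis covers the
  factors of all denominators that meet a nonzero binomial in the longest sum.\<close>

lemma fib_sum_rec:
  assumes e: "\<And>k. 2 * k \<le> m \<Longrightarrow> e + of_nat k \<noteq> 0"
  shows "(4 * e + 2 * of_nat m) * fib_sum b e (m + 2)
     = (4 * e + 3 * of_nat m + 1) * fib_sum b e (m + 1) - (of_nat m + 1 + b) * fib_sum b e m"
proof -
  define c where "c = fib_weight b e"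
  define h where "h = (\<lambda>k. (b + of_nat k) * of_nat ((m - k) choose k) * c k)"
  define D where "D = (\<lambda>k. (4 * e + 2 * of_nat m) * (of_nat ((m + 2 - k) choose k) * c k)
     - (4 * e + 3 * of_nat m + 1) * (of_nat ((m + 1 - k) choose k) * c k)
     + (of_nat m + 1 + b) * (of_nat ((m - k) choose k) * c k))"
  have D0: "D 0 = h 0" unfolding D_def h_def c_def fib_weight_def by simp
  have DS: "D (Suc j) = h (Suc j) - h j" for j
  proof (cases "2 * j \<le> m")
    case False
    thus ?thesis unfolding D_def h_def by (simp add: binomial_eq_0)
  next
    case True
    define x where "x = m - j"
    have m: "m = x + j" using True unfolding x_def by simp
    have p0: "pochhammer e j \<noteq> 0"
    proof
      assume "pochhammer e j = 0"
      then obtain i where "i < j" "e = - of_nat i" by (auto simp: pochhammer_eq_0_iff)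
      thus False using e[of i] True by simp
    qed
    have c: "(b + of_nat j) * c j = - 4 * (e + of_nat j) * c (Suc j)"
      unfolding c_def fib_weight_def pochhammer_Suc power_Suc using p0 e[OF True] by (simp add: divide_simps) (simp add: algebra_simps)
    have 1: "of_nat (Suc x choose Suc j) = of_nat (x choose j) + (of_nat (x choose Suc j) :: complex)"
      by simp
    have 2: "of_nat x * of_nat ((x - 1) choose Suc j) = (of_nat x - of_nat (Suc j)) * (of_nat (x choose Suc j) :: complex)"
      by (rule of_nat_binomial_absorb_comp)
    have 3: "of_nat (Suc j) * of_nat (x choose Suc j) = (of_nat x - of_nat j) * (of_nat (x choose j) :: complex)"
      by (rule of_nat_Suc_times_binomial_Suc)
    define u v w where "u = (of_nat (x choose j) :: complex)" "v = (of_nat (x choose Suc j) :: complex)"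
      "w = (of_nat ((x - 1) choose Suc j) :: complex)"
    have "D (Suc j) = ((4 * e + 2 * of_nat m) * (u + v) - (4 * e + 3 * of_nat m + 1) * v + (of_nat m + 1 + b) * w) * c (Suc j)"
      unfolding D_def u_v_w_def 1[symmetric] m by (simp add: algebra_simps Suc_diff_le)
    \<comment> \<open>The certificate part is split off. The remainder is free of b and e and
      vanishes by the absorption identities 2 and 3.\<close>
    also have "\<dots> = ((b + of_nat (Suc j)) * w + 4 * (e + of_nat j) * u) * c (Suc j)
       + (2 * (of_nat x - of_nat j) * u - (of_nat x + of_nat (Suc j)) * v + of_nat x * w) * c (Suc j)"
      unfolding m by (simp add: algebra_simps)
    also have "2 * (of_nat x - of_nat j) * u - (of_nat x + of_nat (Suc j)) * v + of_nat x * w = 0"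
    proof -
      have "2 * (of_nat x - of_nat j) * u = 2 * (of_nat (Suc j) * v)"
        unfolding u_v_w_def 3 by simp
      moreover have "of_nat x * w = (of_nat x - of_nat (Suc j)) * v"
        unfolding u_v_w_def 2 ..
      ultimately show ?thesis by (simp only:) (simp add: algebra_simps)
    qed
    also have "((b + of_nat (Suc j)) * w + 4 * (e + of_nat j) * u) * c (Suc j) + 0 * c (Suc j)
       = (b + of_nat (Suc j)) * w * c (Suc j) - u * (- 4 * (e + of_nat j) * c (Suc j))"
      by (simp add: algebra_simps)
    also have "\<dots> = h (Suc j) - h j"
      unfolding c[symmetric] h_def u_v_w_def m by (simp add: mult_ac)
    finally show ?thesis .
  qed
  have "(\<Sum>k\<le>M. D k) = h M" for M
    by (induction M) (auto simp: D0 DS)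
  from this[of "m + 2"] have "(\<Sum>k\<le>m+2. D k) = 0" unfolding h_def by (simp add: binomial_eq_0)
  moreover have "(\<Sum>k\<le>m+2. D k) = (4 * e + 2 * of_nat m) * fib_sum b e (m + 2)
     - (4 * e + 3 * of_nat m + 1) * fib_sum b e (m + 1) + (of_nat m + 1 + b) * fib_sum b e m"
    unfolding D_def sum.distrib sum_subtractf sum_distrib_left[symmetric] c_def
    by (subst (1 2 3) fib_sum_eq[of _ "m + 2"]) auto
  ultimately show ?thesis by (simp add: algebra_simps add_eq_0_iff)
qed

text \<open>Both sides equal (-n)_{2k} / 4^k, which is 0 once 2k > n. The factor (-n)_k on the right
  cancels the denominator of the P and Q sums.\<close>

lemma pochhammer_half_mult_half:
  assumes "k \<le> n"
  shows "pochhammer (- ((of_nat n - 1) / 2)) k * pochhammer (- (of_nat n / 2)) k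
     = (of_nat ((n - k) choose k) * fact k * pochhammer (- of_nat n) k * (-1/4) ^ k :: complex)"
  using assms
proof (induction k)
  case 0
  thus ?case by simp
next
  case (Suc k)
  define x where "x = n - k"
  have n: "n = x + k" and x: "n - Suc k = x - 1" using Suc.prems unfolding x_def by auto
  have "of_nat x * of_nat ((x - 1) choose Suc k) * of_nat (Suc k)
     = (of_nat x - of_nat (Suc k)) * ((of_nat x - of_nat k) * (of_nat (x choose k) :: complex))"
    unfolding of_nat_binomial_absorb_comp of_nat_Suc_times_binomial_Suc[of k x, symmetric] by (simp only: mult_ac)
  moreover have "(- ((of_nat n - 1) / 2) + of_nat k) * (- (of_nat n / 2) + of_nat k)
      = (of_nat x - of_nat (Suc k)) * (of_nat x - of_nat k) / (4 :: complex)"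
    unfolding n by (simp add: field_simps)
  moreover have "- of_nat n + of_nat k = (- of_nat x :: complex)" unfolding n by simp
  ultimately have 1: "of_nat ((x - 1) choose Suc k) * of_nat (Suc k) * (- of_nat n + of_nat k) * (-1/4)
    = (- ((of_nat n - 1) / 2) + of_nat k) * (- (of_nat n / 2) + of_nat k) * (of_nat (x choose k) :: complex)"
    by (simp add: mult_ac del: of_nat_Suc)
  have "pochhammer (- ((of_nat n - 1) / 2)) (Suc k) * pochhammer (- (of_nat n / 2)) (Suc k)
     = (- ((of_nat n - 1) / 2) + of_nat k) * (- (of_nat n / 2) + of_nat k) *
       (pochhammer (- ((of_nat n - 1) / 2)) k * pochhammer (- (of_nat n / 2)) k :: complex)"
    by (simp only: pochhammer_Suc mult_ac)
  also have "\<dots> = (- ((of_nat n - 1) / 2) + of_nat k) * (- (of_nat n / 2) + of_nat k) * of_nat (x choose k)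
      * (fact k * pochhammer (- of_nat n) k * (-1/4) ^ k)"
    using Suc by (simp add: x_def mult_ac)
  also have "\<dots> = of_nat ((n - Suc k) choose Suc k) * fact (Suc k) * pochhammer (- of_nat n) (Suc k) * (-1/4) ^ Suc k"
    unfolding 1[symmetric] pochhammer_Suc fact_Suc power_Suc x by (simp only: mult_ac of_nat_mult of_nat_id)
  finally show ?case .
qed

lemma pochhammer_neg_of_nat_nonzero: "k \<le> n \<Longrightarrow> pochhammer (- of_nat n :: complex) k \<noteq> 0"
  by (auto simp: pochhammer_eq_0_iff)

lemma Q_coeff_eq_fib_sum: "Q_coeff a b n = fib_sum b ((a + 1) / 2) n / 2"
proof -
  have M: "nat \<lfloor>real n / 2\<rfloor> = n div 2" by linarith
  have "(\<Sum>k = 0..n div 2. pochhammer (- ((of_nat n - 1) / 2)) k * pochhammer (- (of_nat n / 2)) k * pochhammer b k /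
     (pochhammer (- of_nat n) k * pochhammer ((a + 1) / 2) k * fact k))
     = (\<Sum>k\<le>n div 2. of_nat ((n - k) choose k) * fib_weight b ((a + 1) / 2) k)"
    unfolding atLeast0AtMost
  proof (intro sum.cong refl)
    fix k assume "k \<in> {..n div 2}"
    hence k: "k \<le> n" by simp
    show "pochhammer (- ((of_nat n - 1) / 2)) k * pochhammer (- (of_nat n / 2)) k * pochhammer b k /
     (pochhammer (- of_nat n) k * pochhammer ((a + 1) / 2) k * fact k) = of_nat ((n - k) choose k) * fib_weight b ((a + 1) / 2) k"
      unfolding pochhammer_half_mult_half[OF k] fib_weight_def
      using pochhammer_neg_of_nat_nonzero[OF k] by simp
  qed
  also have "\<dots> = fib_sum b ((a + 1) / 2) n"
    by (rule fib_sum_eq[symmetric]) auto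
  finally show ?thesis unfolding Q_coeff_def M by simp
qed

text \<open>The numerator is the product of \<open>pochhammer_half_mult_half\<close> for n + 1.
  Passing from (-n-1)_k to (-n)_k costs the factor (x + k) / x with x = n + 1 - k, and absorption
  turns (x + k) / x times (x choose k) into 2 (x choose k) - (x - 1 choose k).\<close>

lemma P_coeff_eq_fib_sum: "P_coeff a b n = fib_sum b (a / 2) (n + 1) - fib_sum b (a / 2) n / 2"
proof -
  \<comment> \<open>This is the ceiling of n / 2, the last index with a nonzero binomial in the sum
    for n + 1. It is at most n, so (-n)_k stays nonzero.\<close>
  define M where "M = (n + 1) div 2"
  have M: "nat \<lceil>real n / 2\<rceil> = M" unfolding M_def by linarith
  have "(\<Sum>k = 0..M. pochhammer (- (of_nat n / 2)) k * pochhammer (- ((of_nat n + 1) / 2)) k * pochhammer b k /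
     (pochhammer (- of_nat n) k * pochhammer (a / 2) k * fact k))
     = (\<Sum>k\<le>M. 2 * (of_nat ((n + 1 - k) choose k) * fib_weight b (a / 2) k) - of_nat ((n - k) choose k) * fib_weight b (a / 2) k)"
    unfolding atLeast0AtMost
  proof (intro sum.cong refl)
    fix k assume "k \<in> {..M}"
    hence k: "k \<le> n" unfolding M_def by auto
    define x where "x = n + 1 - k"
    have x: "n = x + k - 1" "n + 1 - k = x" "n - k = x - 1" "x > 0" using k unfolding x_def by auto
    have nx: "of_nat n + 1 = of_nat x + (of_nat k :: complex)"
      using k unfolding x_def by (simp add: of_nat_diff)
    have "pochhammer (- (of_nat n + 1 :: complex)) k * (- (of_nat n + 1) + of_nat k) = - (of_nat n + 1) * pochhammer (- of_nat n) k"
      using pochhammer_rec[of "- (of_nat n + 1 :: complex)" k] by (simp add: pochhammer_Suc)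
    moreover have "- (of_nat n + 1) + of_nat k = - (of_nat x :: complex)"
      unfolding nx by simp
    ultimately have 1: "pochhammer (- (of_nat n + 1 :: complex)) k * of_nat x = (of_nat x + of_nat k) * pochhammer (- of_nat n) k"
      unfolding nx[symmetric] by (metis minus_mult_commute minus_mult_right neg_equal_iff_equal)
    have 2: "of_nat x * of_nat ((x - 1) choose k) = (of_nat x - of_nat k) * (of_nat (x choose k) :: complex)"
      by (rule of_nat_binomial_absorb_comp)
    have "pochhammer (- (of_nat n / 2)) k * pochhammer (- ((of_nat n + 1) / 2)) k
      = of_nat (x choose k) * fact k * pochhammer (- (of_nat n + 1 :: complex)) k * (-1/4) ^ k"
      using pochhammer_half_mult_half[of k "n + 1"] k unfolding x(2) by (simp add: add.commute)
    also have "of_nat (x choose k) * fact k * pochhammer (- (of_nat n + 1 :: complex)) k * (-1/4) ^ k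
      = of_nat (x choose k) * fact k * (pochhammer (- (of_nat n + 1 :: complex)) k * of_nat x) * (-1/4) ^ k / of_nat x"
      using x(4) by simp
    also have "\<dots> = (2 * (of_nat x * of_nat (x choose k)) - (of_nat x - of_nat k) * of_nat (x choose k)) * fact k * pochhammer (- of_nat n) k * (-1/4) ^ k / of_nat x"
      unfolding 1 by (simp add: algebra_simps)
    also have "\<dots> = (2 * of_nat (x choose k) - of_nat ((x - 1) choose k)) * fact k * pochhammer (- of_nat n) k * (-1/4) ^ k"
      unfolding 2[symmetric] using x(4) by (simp add: field_simps)
    finally have 3: "pochhammer (- (of_nat n / 2)) k * pochhammer (- ((of_nat n + 1) / 2 :: complex)) k
       = (2 * of_nat (x choose k) - of_nat ((x - 1) choose k)) * fact k * pochhammer (- of_nat n) k * (-1/4) ^ k" .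
    show "pochhammer (- (of_nat n / 2)) k * pochhammer (- ((of_nat n + 1) / 2)) k * pochhammer b k /
     (pochhammer (- of_nat n) k * pochhammer (a / 2) k * fact k) =
      2 * (of_nat ((n + 1 - k) choose k) * fib_weight b (a / 2) k) - of_nat ((n - k) choose k) * fib_weight b (a / 2) k"
      unfolding 3 fib_weight_def x(2,3)
      using pochhammer_neg_of_nat_nonzero[OF k] by (simp add: diff_divide_distrib algebra_simps)
  qed
  also have "\<dots> = 2 * fib_sum b (a / 2) (n + 1) - fib_sum b (a / 2) n"
    unfolding sum_subtractf sum_distrib_left[symmetric]
    by (subst (1 2) fib_sum_eq[of _ M]) (auto simp: M_def)
  finally show ?thesis unfolding P_coeff_def M by (simp only:) (simp add: field_simps)
qed

section \<open>Recurrences and initial values of P and Q\<close>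

lemma Q_coeff_rec:
  assumes "pochhammer a (Suc (Suc m)) \<noteq> 0"
  shows "2 * (a + of_nat (Suc m)) * Q_coeff a b (Suc (Suc m))
     = (2 * a + 3 * of_nat (Suc m)) * Q_coeff a b (Suc m) - (of_nat (Suc m) + b) * Q_coeff a b m"
proof -
  have "(a + 1) / 2 + of_nat k \<noteq> 0" if "2 * k \<le> m" for k
  proof
    assume "(a + 1) / 2 + of_nat k = 0"
    hence "a = - of_nat (2 * k + 1)" by (simp add: field_simps add_eq_0_iff)
    moreover have "2 * k + 1 < Suc (Suc m)" using that by simp
    ultimately show False using assms unfolding pochhammer_eq_0_iff by blast
  qed
  from fib_sum_rec[of m "(a + 1) / 2" b, OF this] show ?thesis
    unfolding Q_coeff_eq_fib_sum by (simp add: field_simps)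
qed

text \<open>Since P(n) = S(n + 1) - S(n) / 2 with S = \<open>fib_sum b (a / 2)\<close>, the claim is
  the relation for S at m + 1 minus half the relation at m.\<close>

lemma P_coeff_rec:
  assumes "pochhammer a (Suc (Suc m)) \<noteq> 0"
  shows "2 * (a + of_nat (Suc m)) * P_coeff a b (Suc (Suc m))
     = (2 * a + 3 * of_nat (Suc m)) * P_coeff a b (Suc m) - (of_nat (Suc m) + b) * P_coeff a b m"
proof -
  have e: "a / 2 + of_nat k \<noteq> 0" if "2 * k \<le> m + 1" for k
  proof
    assume "a / 2 + of_nat k = 0"
    hence "a = - of_nat (2 * k)" by (simp add: field_simps add_eq_0_iff)
    moreover have "2 * k < Suc (Suc m)" using that by simp
    ultimately show False using assms unfolding pochhammer_eq_0_iff by blast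
  qed
  define S where "S = fib_sum b (a / 2)"
  have 1: "(2 * a + 2 * of_nat m) * S (m + 2) = (2 * a + 3 * of_nat m + 1) * S (m + 1) - (of_nat m + 1 + b) * S m"
    using fib_sum_rec[of m "a / 2" b] e unfolding S_def by simp
  have 2: "(2 * a + 2 * of_nat m + 2) * S (m + 3) = (2 * a + 3 * of_nat m + 4) * S (m + 2) - (of_nat m + 2 + b) * S (m + 1)"
    using fib_sum_rec[of "m + 1" "a / 2" b] e unfolding S_def by (simp add: algebra_simps eval_nat_numeral)
  have "2 * (a + of_nat (Suc m)) * (S (m + 3) - S (m + 2) / 2)
     - ((2 * a + 3 * of_nat (Suc m)) * (S (m + 2) - S (m + 1) / 2) - (of_nat (Suc m) + b) * (S (m + 1) - S m / 2))
    = ((2 * a + 2 * of_nat m + 2) * S (m + 3) - ((2 * a + 3 * of_nat m + 4) * S (m + 2) - (of_nat m + 2 + b) * S (m + 1)))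
      - ((2 * a + 2 * of_nat m) * S (m + 2) - ((2 * a + 3 * of_nat m + 1) * S (m + 1) - (of_nat m + 1 + b) * S m)) / 2"
    by (simp add: field_simps)
  also have "\<dots> = 0" unfolding 1 2 by simp
  finally show ?thesis
    unfolding P_coeff_eq_fib_sum S_def by (simp add: eval_nat_numeral)
qed

lemma PQ_coeff_0: "P_coeff a b 0 = 1 / 2" "Q_coeff a b 0 = 1 / 2"
  unfolding P_coeff_def Q_coeff_def by simp_all

lemma PQ_coeff_1:
  assumes "a \<noteq> 0"
  shows "2 * a * P_coeff a b 1 = a - b" "Q_coeff a b 1 = 1 / 2"
  unfolding P_coeff_eq_fib_sum Q_coeff_def using assms
  by (simp_all add: fib_sum_def fib_weight_def numeral_2_eq_2 field_simps)

section \<open>Contiguous relations and Bailey's theorem\<close>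

definition hyp_series :: "complex \<Rightarrow> complex \<Rightarrow> complex \<Rightarrow> complex \<Rightarrow> complex" where
  "hyp_series A B C z = (\<Sum>k. hyp_coeff A B C k * z ^ k)"

text \<open>Convergence comes from the solution on the slit plane, whose Taylor series at 0 this
  is.\<close>

lemma hyp_series_sums:
  assumes "C \<notin> \<int>\<^sub>\<le>\<^sub>0" "norm z < 1"
  shows "(\<lambda>k. hyp_coeff A B C k * z ^ k) sums hyp_series A B C z"
proof -
  obtain f where "hyp_solution A B C f slit_plane" using ex_hyp_solution_slit_plane[OF assms(1)] by blast
  from hyp_solution_sums[OF hyp_solution_subset[OF this ball_subset_slit_plane] assms] show ?thesis
    unfolding hyp_series_def by (simp add: sums_iff)
qed

text \<open>The multipliers are linear polynomials p + q z; the hypotheses say that the coefficients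
  of z^0 and z^(k+1) of the combination vanish.\<close>

lemma power_series_linear_relation:
  fixes u v w :: "nat \<Rightarrow> complex"
  assumes sums: "(\<lambda>k. u k * z ^ k) sums U" "(\<lambda>k. v k * z ^ k) sums V" "(\<lambda>k. w k * z ^ k) sums W"
    and zero: "p1 * u 0 + p2 * v 0 + p3 * w 0 = 0"
    and Suc: "\<And>k. p1 * u (Suc k) + q1 * u k + p2 * v (Suc k) + q2 * v k + p3 * w (Suc k) + q3 * w k = 0"
  shows "(p1 + q1 * z) * U + (p2 + q2 * z) * V + (p3 + q3 * z) * W = 0"
proof -
  have step: "(\<lambda>k. p * (u (Suc k) * z ^ Suc k) + q * z * (u k * z ^ k)) sums (p * (U - u 0) + q * z * U)"
    if "(\<lambda>k. u k * z ^ k) sums U" for p q U and u :: "nat \<Rightarrow> complex"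
  proof (intro sums_add sums_mult that)
    show "(\<lambda>k. u (Suc k) * z ^ Suc k) sums (U - u 0)"
      using that by (subst sums_Suc_iff) simp
  qed
  have "(\<lambda>k. (p1 * (u (Suc k) * z ^ Suc k) + q1 * z * (u k * z ^ k)) + (p2 * (v (Suc k) * z ^ Suc k) + q2 * z * (v k * z ^ k))
     + (p3 * (w (Suc k) * z ^ Suc k) + q3 * z * (w k * z ^ k)))
    sums ((p1 * (U - u 0) + q1 * z * U) + (p2 * (V - v 0) + q2 * z * V) + (p3 * (W - w 0) + q3 * z * W))"
    (is "?f sums ?S")
    by (intro sums_add step sums)
  moreover have "?f k = 0" for k
  proof -
    have "?f k = (p1 * u (Suc k) + q1 * u k + p2 * v (Suc k) + q2 * v k + p3 * w (Suc k) + q3 * w k) * z ^ Suc k"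
      by (simp add: algebra_simps)
    thus ?thesis unfolding Suc by simp
  qed
  ultimately have "(\<lambda>k::nat. 0) sums ?S" by simp
  hence "?S = 0" by (simp add: sums_iff)
  moreover have "?S = (p1 + q1 * z) * U + (p2 + q2 * z) * V + (p3 + q3 * z) * W - (p1 * u 0 + p2 * v 0 + p3 * w 0)"
    by (simp add: algebra_simps)
  ultimately show ?thesis using zero by simp
qed

section \<open>Gauss's contiguous relations\<close>

lemma nonpos_Ints_plus_one: "C \<notin> \<int>\<^sub>\<le>\<^sub>0 \<Longrightarrow> C + 1 \<notin> (\<int>\<^sub>\<le>\<^sub>0 :: complex set)"
  using plus_one_in_nonpos_Ints_imp by blast

lemma hyp_coeff_0 [simp]: "hyp_coeff A B C 0 = 1"
  unfolding hyp_coeff_def by simp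

lemma pochhammer_nonzero: "C \<notin> \<int>\<^sub>\<le>\<^sub>0 \<Longrightarrow> pochhammer C k \<noteq> (0 :: complex)"
  by (auto dest: pochhammer_eq_0_imp_nonpos_Int)

lemma plus_of_nat_nonzero: "C \<notin> \<int>\<^sub>\<le>\<^sub>0 \<Longrightarrow> C + of_nat k \<noteq> (0 :: complex)"
  using plus_of_nat_eq_0_imp by blast

lemma hyp_series_contiguous_numerator:
  assumes C: "C \<notin> \<int>\<^sub>\<le>\<^sub>0" and z: "norm z < 1"
  shows "(C - A) * hyp_series (A - 1) B C z + (2 * A - C + (B - A) * z) * hyp_series A B C z
    + A * (z - 1) * hyp_series (A + 1) B C z = 0"
proof -
  have "((C - A) + 0 * z) * hyp_series (A - 1) B C z + ((2 * A - C) + (B - A) * z) * hyp_series A B C z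
    + ((- A) + A * z) * hyp_series (A + 1) B C z = 0"
  proof (rule power_series_linear_relation[OF hyp_series_sums hyp_series_sums hyp_series_sums])
    fix k
    \<comment> \<open>A common factor chosen so that every coefficient in the relation, at k and at
      k + 1, is a polynomial multiple of it.\<close>
    define X where "X = pochhammer A k * pochhammer B k / (pochhammer C (Suc k) * fact (Suc k))"
    note nz = pochhammer_nonzero[OF C, of k] plus_of_nat_nonzero[OF C, of k]
    have Suc0: "1 + of_nat k \<noteq> (0::complex)" by (metis of_nat_Suc of_nat_neq_0)
    have "pochhammer (A - 1) (Suc k) = (A - 1) * pochhammer A k" by (simp add: pochhammer_rec)
    hence 1: "hyp_coeff (A - 1) B C (Suc k) = (A - 1) * (B + of_nat k) * X"
      unfolding hyp_coeff_def X_def pochhammer_Suc[of B] by simp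
    have 2: "hyp_coeff A B C (Suc k) = (A + of_nat k) * (B + of_nat k) * X"
      unfolding hyp_coeff_def X_def pochhammer_Suc[of B] pochhammer_Suc[of A] by simp
    have 3: "hyp_coeff A B C k = (C + of_nat k) * of_nat (Suc k) * X"
      unfolding hyp_coeff_def X_def pochhammer_Suc[of C] using nz Suc0 by (simp add: divide_simps)
    \<comment> \<open>The factor A stays attached, since A (A + 1)_k = (A)_{k+1} holds also for A =
      0, where division by A would fail.\<close>
    have 4: "A * hyp_coeff (A + 1) B C (Suc k) = (A + of_nat k) * (A + of_nat (Suc k)) * (B + of_nat k) * X"
    proof -
      have "A * hyp_coeff (A + 1) B C (Suc k) = pochhammer A (Suc (Suc k)) * pochhammer B (Suc k) / (pochhammer C (Suc k) * fact (Suc k))"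
        unfolding hyp_coeff_def pochhammer_rec[of A "Suc k"] by simp
      thus ?thesis unfolding X_def pochhammer_Suc[of B] pochhammer_Suc[of A] by simp
    qed
    have 5: "A * hyp_coeff (A + 1) B C k = (A + of_nat k) * ((C + of_nat k) * of_nat (Suc k) * X)"
    proof -
      have "A * hyp_coeff (A + 1) B C k = pochhammer A (Suc k) * pochhammer B k / (pochhammer C k * fact k)"
        unfolding hyp_coeff_def pochhammer_rec[of A k] by simp
      thus ?thesis unfolding 3[symmetric] hyp_coeff_def pochhammer_Suc[of A] by (simp add: mult_ac)
    qed
    show "(C - A) * hyp_coeff (A - 1) B C (Suc k) + 0 * hyp_coeff (A - 1) B C k + (2 * A - C) * hyp_coeff A B C (Suc k)
       + (B - A) * hyp_coeff A B C k + - A * hyp_coeff (A + 1) B C (Suc k) + A * hyp_coeff (A + 1) B C k = 0"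
      unfolding mult_minus_left 1 2 3 4 5 by (simp add: algebra_simps)
  qed (use C z in auto)
  thus ?thesis by (simp add: algebra_simps)
qed

text \<open>For A = - b the right side has the parameters 1 - b, b over C and C + 1, both within
  reach of Bailey's formula.\<close>

lemma hyp_series_contiguous_both:
  assumes C: "C \<notin> \<int>\<^sub>\<le>\<^sub>0" and z: "norm z < 1"
  shows "C * hyp_series A B C z = C * (1 - z) * hyp_series (A + 1) B C z + (C - B) * z * hyp_series (A + 1) B (C + 1) z"
proof -
  have "(C + 0 * z) * hyp_series A B C z + ((- C) + C * z) * hyp_series (A + 1) B C z
    + (0 + (- (C - B)) * z) * hyp_series (A + 1) B (C + 1) z = 0"
  proof (rule power_series_linear_relation[OF hyp_series_sums hyp_series_sums hyp_series_sums])
    fix k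
    define X where "X = pochhammer (A + 1) k * pochhammer B k / (pochhammer C (Suc k) * fact (Suc k))"
    note nz = pochhammer_nonzero[OF C, of k] plus_of_nat_nonzero[OF C, of k] plus_of_nat_nonzero[OF C, of 0]
      pochhammer_nonzero[OF nonpos_Ints_plus_one[OF C], of k]
    have Suc0: "1 + of_nat k \<noteq> (0::complex)" by (metis of_nat_Suc of_nat_neq_0)
    have 1: "hyp_coeff A B C (Suc k) = A * (B + of_nat k) * X"
      unfolding hyp_coeff_def X_def pochhammer_Suc[of B] pochhammer_rec[of A] by simp
    have 2: "hyp_coeff (A + 1) B C (Suc k) = (A + of_nat (Suc k)) * (B + of_nat k) * X"
      unfolding hyp_coeff_def X_def pochhammer_Suc[of B] pochhammer_Suc[of "A + 1"] by simp
    have 3: "hyp_coeff (A + 1) B C k = (C + of_nat k) * of_nat (Suc k) * X"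
      unfolding hyp_coeff_def X_def pochhammer_Suc[of C] using nz Suc0 by (simp add: divide_simps)
    have 4: "hyp_coeff (A + 1) B (C + 1) k = C * of_nat (Suc k) * X"
      unfolding hyp_coeff_def X_def pochhammer_rec[of C] using nz Suc0 by (simp add: divide_simps)
    show "C * hyp_coeff A B C (Suc k) + 0 * hyp_coeff A B C k + - C * hyp_coeff (A + 1) B C (Suc k)
       + C * hyp_coeff (A + 1) B C k + 0 * hyp_coeff (A + 1) B (C + 1) (Suc k) + - (C - B) * hyp_coeff (A + 1) B (C + 1) k = 0"
      unfolding 1 2 3 4 by (simp add: algebra_simps)
  qed (use C z nonpos_Ints_plus_one[OF C] in auto)
  thus ?thesis by (simp add: algebra_simps)
qed

text \<open>At z = 1/2 with A + B = 1 the middle coefficient C - (2 C + 1 - A - B) z is 0; what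
  remains is the two-term relation behind Bailey's formula.\<close>

lemma hyp_series_contiguous_denominator:
  assumes C: "C \<notin> \<int>\<^sub>\<le>\<^sub>0" and z: "norm z < 1"
  shows "(C + 1 - A) * (C + 1 - B) * z * hyp_series A B (C + 2) z
     + (C + 1) * (C - (2 * C + 1 - A - B) * z) * hyp_series A B (C + 1) z
     = C * (C + 1) * (1 - z) * hyp_series A B C z"
proof -
  have C1: "C + 1 \<notin> \<int>\<^sub>\<le>\<^sub>0" using C by (rule nonpos_Ints_plus_one)
  have C2: "C + 2 \<notin> \<int>\<^sub>\<le>\<^sub>0" using nonpos_Ints_plus_one[OF C1] by (simp add: add.assoc)
  have "(0 + (C + 1 - A) * (C + 1 - B) * z) * hyp_series A B (C + 2) z
     + ((C + 1) * C + (- ((C + 1) * (2 * C + 1 - A - B))) * z) * hyp_series A B (C + 1) z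
     + ((- (C * (C + 1))) + (C * (C + 1)) * z) * hyp_series A B C z = 0"
  proof (rule power_series_linear_relation[OF hyp_series_sums hyp_series_sums hyp_series_sums])
    fix k
    define X where "X = pochhammer A k * pochhammer B k / (pochhammer C (Suc (Suc k)) * fact (Suc k))"
    have Suc0: "1 + of_nat k \<noteq> (0::complex)" by (metis of_nat_Suc of_nat_neq_0)
    note nz = pochhammer_nonzero[OF C, of k] plus_of_nat_nonzero[OF C, of k] plus_of_nat_nonzero[OF C, of "Suc k"]
      plus_of_nat_nonzero[OF C, of 0] plus_of_nat_nonzero[OF C, of 1]
      pochhammer_nonzero[OF C1, of k] pochhammer_nonzero[OF C2, of k] pochhammer_nonzero[OF C1, of "Suc k"]
    have 1: "hyp_coeff A B (C + 2) k = C * (C + 1) * of_nat (Suc k) * X"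
    proof -
      have "pochhammer C (Suc (Suc k)) = C * (C + 1) * pochhammer (C + 2) k"
        by (simp add: pochhammer_rec add.assoc)
      thus ?thesis
        unfolding hyp_coeff_def X_def using nz Suc0 by (simp add: divide_simps)
    qed
    have 2: "hyp_coeff A B (C + 1) (Suc k) = C * (A + of_nat k) * (B + of_nat k) * X"
      unfolding hyp_coeff_def X_def pochhammer_Suc[of A] pochhammer_Suc[of B] pochhammer_rec[of C]
      using nz by (simp add: divide_simps)
    have e1: "pochhammer (C + 1) (Suc k) = pochhammer (C + 1) k * (C + of_nat (Suc k))"
      by (simp add: pochhammer_Suc add_ac)
    have 3: "hyp_coeff A B (C + 1) k = C * (C + of_nat (Suc k)) * of_nat (Suc k) * X"
      unfolding hyp_coeff_def X_def pochhammer_rec[of C] e1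
      using nz Suc0 by (simp add: divide_simps del: of_nat_Suc)
    have 4: "hyp_coeff A B C (Suc k) = (C + of_nat (Suc k)) * (A + of_nat k) * (B + of_nat k) * X"
      unfolding hyp_coeff_def X_def pochhammer_Suc[of A] pochhammer_Suc[of B] pochhammer_Suc[of C]
      using nz by (simp add: divide_simps del: of_nat_Suc)
    have 5: "hyp_coeff A B C k = (C + of_nat k) * (C + of_nat (Suc k)) * of_nat (Suc k) * X"
      unfolding hyp_coeff_def X_def pochhammer_Suc[of C]
      using nz Suc0 by (simp add: divide_simps del: of_nat_Suc)
    show "0 * hyp_coeff A B (C + 2) (Suc k) + (C + 1 - A) * (C + 1 - B) * hyp_coeff A B (C + 2) k
       + (C + 1) * C * hyp_coeff A B (C + 1) (Suc k) + - ((C + 1) * (2 * C + 1 - A - B)) * hyp_coeff A B (C + 1) k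
       + - (C * (C + 1)) * hyp_coeff A B C (Suc k) + C * (C + 1) * hyp_coeff A B C k = 0"
      unfolding 1 2 3 4 5 by (simp add: algebra_simps)
  qed (use C C1 C2 z in auto)
  thus ?thesis by (simp add: algebra_simps)
qed

text \<open>The first factor is at most |B| / Re C and every later one at most 1, which gives a
  bound that is uniform in k and tends to 0 with growing Re C.\<close>

lemma norm_pochhammer_quotient_le:
  assumes C: "Re C > 0" "norm B \<le> Re C" and k: "k > 0"
  shows "norm (pochhammer B k / pochhammer C k) \<le> norm B / Re C"
  using k
proof (induction k rule: nat_induct_non_zero)
  case 1
  show ?case using C complex_Re_le_cmod[of C] by (simp add: norm_divide frac_le)
next
  case (Suc k)
  have "norm (B + of_nat k) \<le> norm B + k" using norm_triangle_ineq[of B "of_nat k"] by simp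
  also have "\<dots> \<le> Re (C + of_nat k)" using C by simp
  also have "\<dots> \<le> norm (C + of_nat k)" by (rule complex_Re_le_cmod)
  finally have "norm ((B + of_nat k) / (C + of_nat k)) \<le> 1"
    by (simp add: norm_divide divide_le_eq_1 del: of_nat_Suc)
  hence "norm (pochhammer B k / pochhammer C k) * norm ((B + of_nat k) / (C + of_nat k)) \<le> norm B / Re C * 1"
    using Suc C by (intro mult_mono) auto
  thus ?case by (simp add: pochhammer_Suc norm_mult[symmetric])
qed

lemma hyp_series_tendsto_1:
  assumes z: "norm z < 1" and C: "filterlim (\<lambda>n. Re (C n)) at_top sequentially"
  shows "(\<lambda>n. hyp_series A B (C n) z) \<longlonglongrightarrow> 1"
proof -
  define a where "a = (\<lambda>k. norm (pochhammer A k / fact k * z ^ k))"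
  have "summable a"
  proof -
    \<comment> \<open>With B = C = 1 the series is the binomial series with coefficients (A)_k / k!;
      convergence at some r > |z| gives absolute convergence at z.\<close>
    obtain r where r: "norm z < r" "r < 1" using z dense by blast
    have "summable (\<lambda>k. hyp_coeff A 1 1 k * of_real r ^ k)"
      by (rule sums_summable[OF hyp_series_sums]) (use r norm_ge_zero[of z] in linarith | simp)+
    hence "summable (\<lambda>k. norm (hyp_coeff A 1 1 k * z ^ k))"
      by (rule powser_insidea) (use r norm_ge_zero[of z] in simp)
    thus ?thesis unfolding a_def hyp_coeff_def by (simp flip: pochhammer_fact)
  qed
  hence sa: "summable (\<lambda>k. a (Suc k))" by (subst summable_Suc_iff)
  have bound: "norm (hyp_series A B c z - 1) \<le> norm B / Re c * (\<Sum>k. a (Suc k))"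
    if c: "Re c > norm B" for c
  proof -
    have c0: "Re c > 0" using c norm_ge_zero[of B] by linarith
    hence "c \<notin> \<int>\<^sub>\<le>\<^sub>0" by (auto elim!: nonpos_Ints_cases)
    hence "(\<lambda>k. hyp_coeff A B c k * z ^ k) sums hyp_series A B c z" using z by (intro hyp_series_sums)
    hence S: "(\<lambda>k. hyp_coeff A B c (Suc k) * z ^ Suc k) sums (hyp_series A B c z - 1)"
      by (subst sums_Suc_iff) simp
    have le: "norm (hyp_coeff A B c (Suc k) * z ^ Suc k) \<le> norm B / Re c * a (Suc k)" for k
    proof -
      have "hyp_coeff A B c (Suc k) * z ^ Suc k
         = pochhammer B (Suc k) / pochhammer c (Suc k) * (pochhammer A (Suc k) / fact (Suc k) * z ^ Suc k)"
        unfolding hyp_coeff_def by (simp only: times_divide_eq_left times_divide_eq_right divide_divide_eq_left mult_ac)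
      moreover have "norm (pochhammer B (Suc k) / pochhammer c (Suc k)) \<le> norm B / Re c"
        by (rule norm_pochhammer_quotient_le) (use c c0 in auto)
      ultimately show ?thesis unfolding a_def by (simp only: norm_mult[of "_ / pochhammer c _"] mult_right_mono norm_ge_zero)
    qed
    have "norm (\<Sum>k. hyp_coeff A B c (Suc k) * z ^ Suc k) \<le> (\<Sum>k. norm B / Re c * a (Suc k))"
      by (rule norm_suminf_le[OF le summable_mult[OF sa]])
    also have "(\<Sum>k. hyp_coeff A B c (Suc k) * z ^ Suc k) = hyp_series A B c z - 1"
      using S by (rule sums_unique[symmetric])
    also have "(\<Sum>k. norm B / Re c * a (Suc k)) = norm B / Re c * (\<Sum>k. a (Suc k))"
      by (rule suminf_mult[OF sa])
    finally show ?thesis .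
  qed
  have "(\<lambda>n. norm B / Re (C n) * (\<Sum>k. a (Suc k))) \<longlonglongrightarrow> 0 * (\<Sum>k. a (Suc k))"
    by (intro tendsto_mult tendsto_const tendsto_divide_0[OF tendsto_const] filterlim_at_top_imp_at_infinity C)
  hence lim: "(\<lambda>n. norm B / Re (C n) * (\<Sum>k. a (Suc k))) \<longlonglongrightarrow> 0" by (simp only: mult_zero_left)
  have "eventually (\<lambda>n. norm B < Re (C n)) sequentially"
    using C unfolding filterlim_at_top_dense by blast
  hence "eventually (\<lambda>n. norm (hyp_series A B (C n) z - 1) \<le> norm B / Re (C n) * (\<Sum>k. a (Suc k))) sequentially"
    by (rule eventually_mono) (rule bound)
  from Lim_null_comparison[OF this lim] have "(\<lambda>n. hyp_series A B (C n) z - 1) \<longlonglongrightarrow> 0" .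
  thus ?thesis by (simp add: LIM_zero_iff)
qed

text \<open>Iterating the relation in C puts a product of two Pochhammer symbols on each side.
  Rescaled as in Euler's limit these tend to \<open>rGamma\<close> values, while the shifted series
  tends to 1.\<close>

lemma hyp_series_Bailey:
  assumes C: "C \<notin> \<int>\<^sub>\<le>\<^sub>0"
  shows "hyp_series (1 - b) b C (1 / 2)
    = 2 powr (1 - C) * of_real (sqrt pi) * Gamma C * rGamma ((C + b) / 2) * rGamma ((C + 1 - b) / 2)"
proof -
  define H where "H = (\<lambda>C. hyp_series (1 - b) b C (1 / 2))"
  have step: "C * (C + 1) * H C = (C + b) * (C + 1 - b) * H (C + 2)" if "C \<notin> \<int>\<^sub>\<le>\<^sub>0" for C
  proof -
    have "C + 1 - (1 - b) = C + b" "C - (2 * C + 1 - (1 - b) - b) * (1 / 2) = 0"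
      by (simp_all add: field_simps)
    thus ?thesis
      using hyp_series_contiguous_denominator[OF that, of "1 / 2" "1 - b" b] unfolding H_def by simp
  qed
  have Cm: "C + 2 * of_nat m \<notin> \<int>\<^sub>\<le>\<^sub>0" for m
  proof
    assume "C + 2 * of_nat m \<in> \<int>\<^sub>\<le>\<^sub>0"
    then obtain j where "C + 2 * of_nat m = - of_nat j" by (elim nonpos_Ints_cases')
    hence "C = - of_nat (j + 2 * m)" by (simp add: algebra_simps add_eq_0_iff eq_diff_eq)
    thus False using C by (metis minus_of_nat_in_nonpos_Ints)
  qed
  have iter: "pochhammer (C / 2) m * pochhammer ((C + 1) / 2) m * H C
     = pochhammer ((C + b) / 2) m * pochhammer ((C + 1 - b) / 2) m * H (C + 2 * of_nat m)" for m
  proof (induction m)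
    case (Suc m)
    define c where "c = C + 2 * of_nat m"
    have "pochhammer (C / 2) (Suc m) * pochhammer ((C + 1) / 2) (Suc m) * H C
       = (pochhammer (C / 2) m * pochhammer ((C + 1) / 2) m * H C) * (c * (c + 1)) / 4"
      unfolding pochhammer_Suc c_def by (simp add: field_simps)
    also have "\<dots> = pochhammer ((C + b) / 2) m * pochhammer ((C + 1 - b) / 2) m * (c * (c + 1) * H c) / 4"
      unfolding Suc c_def by simp
    also have "c * (c + 1) * H c = (c + b) * (c + 1 - b) * H (c + 2)"
      by (rule step) (use Cm c_def in simp)
    also have "pochhammer ((C + b) / 2) m * pochhammer ((C + 1 - b) / 2) m * ((c + b) * (c + 1 - b) * H (c + 2)) / 4
       = pochhammer ((C + b) / 2) (Suc m) * pochhammer ((C + 1 - b) / 2) (Suc m) * H (C + 2 * of_nat (Suc m))"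
    proof -
      have eqs: "C + 2 * of_nat (Suc m) = c + 2" "(C + b) / 2 + of_nat m = (c + b) / 2" "(C + 1 - b) / 2 + of_nat m = (c + 1 - b) / 2"
        unfolding c_def by (simp_all add: field_simps)
      show ?thesis unfolding pochhammer_Suc eqs by simp
    qed
    finally show ?case .
  qed simp
  have "(\<lambda>n. rGamma_series (C / 2) n * rGamma_series ((C + 1) / 2) n * H C)
     \<longlonglongrightarrow> rGamma (C / 2) * rGamma ((C + 1) / 2) * H C"
    by (intro tendsto_intros)
  moreover have "rGamma_series (C / 2) n * rGamma_series ((C + 1) / 2) n * H C
     = rGamma_series ((C + b) / 2) n * rGamma_series ((C + 1 - b) / 2) n * H (C + 2 * of_nat (Suc n))" for n
  proof -
    \<comment> \<open>The powers of n hidden in \<open>rGamma_series\<close> cancel because C/2 + (C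
      + 1)/2 and (C + b)/2 + (C + 1 - b)/2 are the same sum. The iteration count is
      \<open>Suc n\<close> since \<open>rGamma_series\<close> at n has n + 1 Pochhammer
      factors.\<close>
    define E where "E = (\<lambda>z. exp (z * of_real (ln (real n))) :: complex)"
    have "E (C / 2) * E ((C + 1) / 2) = E ((C + b) / 2) * E ((C + 1 - b) / 2)"
      unfolding E_def exp_add[symmetric] by (rule arg_cong[of _ _ exp]) (simp add: field_simps)
    moreover have "rGamma_series z n * rGamma_series w n * h
       = (pochhammer z (Suc n) * pochhammer w (Suc n) * h) / (fact n ^ 2 * (E z * E w))" for z w h :: complex
      unfolding rGamma_series_def E_def by (simp add: power2_eq_square mult_ac)
    ultimately show ?thesis using iter[of "Suc n"] by simp
  qed
  ultimately have "(\<lambda>n. rGamma_series ((C + b) / 2) n * rGamma_series ((C + 1 - b) / 2) n * H (C + 2 * of_nat (Suc n)))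
     \<longlonglongrightarrow> rGamma (C / 2) * rGamma ((C + 1) / 2) * H C"
    by simp
  moreover have "(\<lambda>n. rGamma_series ((C + b) / 2) n * rGamma_series ((C + 1 - b) / 2) n * H (C + 2 * of_nat (Suc n)))
     \<longlonglongrightarrow> rGamma ((C + b) / 2) * rGamma ((C + 1 - b) / 2) * 1"
  proof (intro tendsto_mult rGamma_series_LIMSEQ)
    have "filterlim (\<lambda>n. Re C + 2 * real (Suc n)) at_top sequentially" by real_asymp
    thus "(\<lambda>n. H (C + 2 * of_nat (Suc n))) \<longlonglongrightarrow> 1"
      unfolding H_def by (intro hyp_series_tendsto_1) simp_all
  qed
  ultimately have "rGamma (C / 2) * rGamma ((C + 1) / 2) * H C = rGamma ((C + b) / 2) * rGamma ((C + 1 - b) / 2) * 1"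
    by (rule LIMSEQ_unique)
  moreover have "rGamma (C / 2) * rGamma ((C + 1) / 2) * (Gamma (C / 2) * Gamma ((C + 1) / 2)) = 1"
    using Gamma_halves_product(1,2)[OF C] unfolding rGamma_inverse_Gamma
    by (simp add: Gamma_eq_zero_iff field_simps)
  moreover have "h = G * y" if "r * h = y * 1" "r * G = 1" for r h G y :: complex
    using that by (metis mult.assoc mult.commute mult_1)
  ultimately have "H C = Gamma (C / 2) * Gamma ((C + 1) / 2) * (rGamma ((C + b) / 2) * rGamma ((C + 1 - b) / 2))"
    by blast
  thus ?thesis unfolding Gamma_halves_product(3)[OF C] H_def by (simp add: mult_ac)
qed

section \<open>The generalized Kummer identity\<close>

theorem theorem2:
  fixes n :: nat and a b :: complex
  assumes "pochhammer a n \<noteq> 0"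
    and "a - b \<notin> \<int>\<^sub>\<le>\<^sub>0"
  shows "hyp2F1 (a + of_nat n) b (a - b) (- 1) =
      P_coeff a b n * (Gamma (a - b) * Gamma_quot_odd a * rGamma ((a + 1) / 2 - b))
    + Q_coeff a b n * (Gamma (a - b) * Gamma_quot_even a * rGamma (a / 2 - b))"
proof -
  define X where "X = Gamma (a - b) * Gamma_quot_odd a * rGamma ((a + 1) / 2 - b)"
  define Y where "Y = Gamma (a - b) * Gamma_quot_even a * rGamma (a / 2 - b)"
  \<comment> \<open>The shift r is complex so that the recurrence can start from r = -1.\<close>
  define T where "T = (\<lambda>r. 2 powr (- b) * hyp_series (- b - r) b (a - b) (1 / 2))"
  have ab: "a - b + 1 \<notin> \<int>\<^sub>\<le>\<^sub>0" "a - b \<noteq> 0"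
    using nonpos_Ints_plus_one[OF assms(2)] assms(2) by auto
  have "2 powr (- b) * 2 powr (1 - (a - b + 1)) = (2 powr (1 - a - 1) :: complex)"
    by (subst powr_add[symmetric]) simp
  also have "\<dots> = 2 powr (1 - a) / 2" by (subst powr_diff) simp
  finally have pw2: "2 powr (- b) * 2 powr (1 - (a - b + 1)) = (2 powr (1 - a) / 2 :: complex)" .
  have pw1: "2 powr (- b) * 2 powr (1 - (a - b)) = (2 powr (1 - a) :: complex)"
    by (subst powr_add[symmetric]) simp
  have hyp: "hyp2F1 (a + r) b (a - b) (- 1) = T r" for r
  proof -
    have "a - b - (a + r) = - b - r" by simp
    with hyp2F1_minus_one[OF assms(2), of "a + r" b]
    have "2 powr b * hyp2F1 (a + r) b (a - b) (-1) = hyp_series (- b - r) b (a - b) (1 / 2)"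
      unfolding hyp_series_def by (simp only: sums_unique)
    moreover have "2 powr (- b) * (2 powr b * x) = x" for x :: complex
      by (simp add: powr_minus)
    ultimately show ?thesis unfolding T_def by metis
  qed
  have Tm1: "T (- 1) = X"
  proof -
    have "T (- 1) = 2 powr (- b) * hyp_series (1 - b) b (a - b) (1 / 2)" unfolding T_def by simp
    also have "\<dots> = 2 powr (- b) * 2 powr (1 - (a - b)) * of_real (sqrt pi) * Gamma (a - b) * rGamma (a / 2) * rGamma ((a - b + 1 - b) / 2)"
      unfolding hyp_series_Bailey[OF assms(2)] by (simp add: mult_ac)
    also have "(a - b + 1 - b) / 2 = (a + 1) / 2 - b" by (simp add: field_simps)
    finally show ?thesis unfolding pw1 X_def Gamma_quot_odd_def by (simp add: mult_ac)
  qed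
  have T0: "T 0 = X / 2 + Y / 2"
  proof -
    define h where "h = hyp_series (1 - b) b (a - b + 1) (1 / 2)"
    define h0 where "h0 = hyp_series (- b) b (a - b) (1 / 2)"
    define h1 where "h1 = hyp_series (1 - b) b (a - b) (1 / 2)"
    have "(a - b) * h0 = (a - b) * (1 - 1 / 2) * h1 + (a - b - b) * (1 / 2) * h"
      using hyp_series_contiguous_both[OF assms(2), of "1 / 2" "- b" b]
      unfolding h_def h0_def h1_def by simp
    moreover have "(a - b) * (p * h0) = p * ((a - b) * h0)" for p by simp
    ultimately have "(a - b) * (p * h0) = (a - b) * (p * h1) / 2 + (a - 2 * b) * (p * h) / 2" for p
      by (simp only:) (simp add: field_simps)
    from this[of "2 powr (- b)"] have "(a - b) * T 0 = (a - b) * T (- 1) / 2 + (a - 2 * b) * (2 powr (- b) * h) / 2"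
      unfolding T_def h0_def h1_def by simp
    \<comment> \<open>The factor a - 2b = 2 (a/2 - b) lowers the argument of \<open>rGamma\<close>
      from a/2 - b + 1 to a/2 - b, and Gamma (a - b + 1) releases a - b: this is how Y
      arises.\<close>
    also have "(a - 2 * b) * (2 powr (- b) * h)
       = 2 powr (- b) * 2 powr (1 - (a - b + 1)) * 2 * of_real (sqrt pi) * Gamma (a - b + 1) * rGamma ((a - b + 1 + b) / 2)
          * ((a / 2 - b) * rGamma ((a - b + 1 + 1 - b) / 2))"
      unfolding h_def hyp_series_Bailey[OF ab(1)] by (simp add: algebra_simps)
    also have "(a - b + 1 + 1 - b) / 2 = a / 2 - b + 1" by (simp add: field_simps)
    also have "(a / 2 - b) * rGamma (a / 2 - b + 1) = rGamma (a / 2 - b)" by (rule rGamma_plus1)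
    also have "Gamma (a - b + 1) = (a - b) * Gamma (a - b)" using assms(2) by (rule Gamma_plus1)
    also have "2 powr (- b) * 2 powr (1 - (a - b + 1)) * 2 * of_real (sqrt pi) * ((a - b) * Gamma (a - b)) * rGamma ((a - b + 1 + b) / 2) * rGamma (a / 2 - b)
       = (a - b) * Y"
      unfolding pw2 Y_def Gamma_quot_even_def by (simp add: mult_ac)
    finally have "(a - b) * T 0 = (a - b) * (X / 2 + Y / 2)" unfolding Tm1 by (simp add: algebra_simps)
    thus ?thesis using ab(2) by (metis mult_left_cancel)
  qed
  have Trec: "2 * (a + r) * T (r + 1) = (2 * a + 3 * r) * T r - (r + b) * T (r - 1)" for r
  proof -
    define h where "h = (\<lambda>r. hyp_series (- b - r) b (a - b) (1 / 2))"
    have half: "norm (1 / 2 :: complex) < 1" by simp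
    have shift: "- b - r - 1 = - b - (r + 1)" "- b - r + 1 = - b - (r - 1)" by simp_all
    have "2 * (a + r) * h (r + 1) - ((2 * a + 3 * r) * h r - (r + b) * h (r - 1))
       = 2 * ((a - b - (- b - r)) * h (r + 1) + (2 * (- b - r) - (a - b) + (b - (- b - r)) * (1 / 2)) * h r
          + (- b - r) * (1 / 2 - 1) * h (r - 1))"
      by (simp add: field_simps)
    also have "\<dots> = 0"
      using hyp_series_contiguous_numerator[OF assms(2) half, of "- b - r" b, unfolded shift]
      unfolding h_def by (simp only: mult_zero_right)
    finally have "2 * (a + r) * h (r + 1) = (2 * a + 3 * r) * h r - (r + b) * h (r - 1)"
      by simp
    moreover have "2 * (a + r) * (p * h (r + 1)) = p * (2 * (a + r) * h (r + 1))" for p by simp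
    ultimately have "2 * (a + r) * (p * h (r + 1)) = (2 * a + 3 * r) * (p * h r) - (r + b) * (p * h (r - 1))" for p
      by (simp only:) (simp add: algebra_simps)
    thus ?thesis unfolding T_def h_def .
  qed
  have "pochhammer a n \<noteq> 0 \<Longrightarrow> T (of_nat n) = P_coeff a b n * X + Q_coeff a b n * Y"
  proof (induction n rule: less_induct)
    case (less n)
    \<comment> \<open>The case n = 1 stands apart because the recurrence then reaches back to
      \<open>T (- 1)\<close>, outside the range of the induction.\<close>
    consider "n = 0" | "n = 1" | m where "n = Suc (Suc m)"
      by (metis One_nat_def not0_implies_Suc)
    thus ?case
    proof cases
      case 1
      thus ?thesis using T0 by (simp add: PQ_coeff_0)
    next
      case 2
      have a: "a \<noteq> 0" using less.prems 2 by simp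
      have "2 * a * T 1 = 2 * a * T 0 - b * T (- 1)" using Trec[of 0] by simp
      also have "\<dots> = (a - b) * X + a * Y" unfolding T0 Tm1 by (simp add: algebra_simps)
      also have "\<dots> = 2 * a * (P_coeff a b 1 * X + Q_coeff a b 1 * Y)"
        unfolding PQ_coeff_1(1)[OF a, of b, symmetric] PQ_coeff_1(2)[OF a] by (simp add: algebra_simps)
      finally show ?thesis using a 2 by simp
    next
      case (3 m)
      have nz: "pochhammer a (Suc (Suc m)) \<noteq> 0" using less.prems 3 by simp
      hence a: "a + of_nat (Suc m) \<noteq> 0" by (simp add: pochhammer_Suc add_ac)
      have IH: "T (of_nat (Suc m)) = P_coeff a b (Suc m) * X + Q_coeff a b (Suc m) * Y"
        "T (of_nat m) = P_coeff a b m * X + Q_coeff a b m * Y"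
        using less.IH[of "Suc m"] less.IH[of m] nz 3 by (auto simp: pochhammer_Suc)
      have "2 * (a + of_nat (Suc m)) * T (of_nat (Suc (Suc m)))
         = (2 * a + 3 * of_nat (Suc m)) * T (of_nat (Suc m)) - (of_nat (Suc m) + b) * T (of_nat m)"
        using Trec[of "of_nat (Suc m)"] by (simp add: add_ac)
      also have "\<dots> = ((2 * a + 3 * of_nat (Suc m)) * P_coeff a b (Suc m) - (of_nat (Suc m) + b) * P_coeff a b m) * X
         + ((2 * a + 3 * of_nat (Suc m)) * Q_coeff a b (Suc m) - (of_nat (Suc m) + b) * Q_coeff a b m) * Y"
        unfolding IH by (simp add: algebra_simps)
      also have "\<dots> = 2 * (a + of_nat (Suc m)) * (P_coeff a b n * X + Q_coeff a b n * Y)"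
        unfolding P_coeff_rec[OF nz, symmetric] Q_coeff_rec[OF nz, symmetric] 3 by (simp only: algebra_simps)
      finally have "2 * (a + of_nat (Suc m)) * T (of_nat n) = 2 * (a + of_nat (Suc m)) * (P_coeff a b n * X + Q_coeff a b n * Y)"
        unfolding 3 .
      moreover have "2 * (a + of_nat (Suc m)) \<noteq> 0" using a by (simp only: mult_eq_0_iff) simp
      ultimately show ?thesis by (metis mult_left_cancel)
    qed
  qed
  thus ?thesis using assms(1) unfolding hyp X_def Y_def by simp
qed

end
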